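(* Let $\Omega=\overline{\mathbb E}$ be the closure of the tetrablock. Then $$\mathrm{COT}_0(\Omega)=\mathrm{MIN}(\ell_1^2\oplus_\infty\mathbb C)$$ completely isometrically, under the identification $(c_1,c_2,c_3)\mapsto((c_1,c_2),c_3)$ of $\mathbb C^3$ with $\ell_1^2\oplus_\infty\mathbb C$. That is, for every $k\ge1$ this identification, applied entrywise, is an isometry from $M_k(\mathbb C^3)$ with the $k$-th matrix norm of $\mathrm{COT}_0(\Omega)$ onto $M_k(\ell_1^2\oplus_\infty\mathbb C)$ with the $k$-th matrix norm of $\mathrm{MIN}(\ell_1^2\oplus_\infty\mathbb C)$.
   Context: The tetrablock is $\mathbb E=\{(x_1,x_2,x_3)\in\mathbb C^3: 1-x_1z-x_2w+x_3zw\neq0\text{ for all }z,w\in\overline{\mathbb D}\}$, where $\overline{\mathbb D}$ is the closed unit disc. $M_k$ is the space of complex $k\times k$ matrices with the operator norm on Euclidean $\mathbb C^k$. For compact $\Omega\subseteq\mathbb C^m$, $\mathrm{Rat}(\Omega)$ is the algebra of rational functions $p/q$ with $p,q\in\mathbb C[z_1,\dots,z_m]$ and $q$ nowhere zero on $\Omega$; for $F\in M_k(\mathrm{Rat}(\Omega))$ put $\|F\|_{M_k(\mathrm{Rat}(\Omega))}=\sup_{z\in\Omega}\|F(z)\|$. For $w$ in the interior of $\Omega$ and $F=(f_{ij})\in M_k(\mathrm{Rat}(\Omega))$ set $DF(w)=\left(\frac{\partial F}{\partial z_1}(w),\dots,\frac{\partial F}{\partial z_m}(w)\right)$ (entrywise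 derivatives), an $m$-tuple of $k\times k$ matrices. The space of $m$-tuples $(B_1,\dots,B_m)\in M_k^m$ is identified with $M_k(\mathbb C^m)=M_k\otimes\mathbb C^m$ via $(B_1,\dots,B_m)=\sum_r B_r\otimes e_r$, where $e_1,\dots,e_m$ is the standard basis of $\mathbb C^m$. Let $\mathcal D^{(k)}_{\Omega,w}\subseteq M_k(\mathbb C^m)$ be the closure of $$\{DF(w): F\in M_k(\mathrm{Rat}(\Omega)),\ \|F\|_{M_k(\mathrm{Rat}(\Omega))}\le1,\ F(w)=0\}.$$ It is known (Paulsen) that $\mathcal D^{(k)}_{\Omega,w}$ is the closed unit ball of a norm on $M_k(\mathbb C^m)$ for each $k\geq 1$, and that these norms make $\mathbb C^m$ an abstract operator space. This operator space is the cotangent operator space $\mathrm{COT}_w(\Omega)$. $\ell_1^2$ is $\mathbb C^2$ with norm $|c_1|+|c_2|$, and $X\oplus_\infty Y$ is the direct sum with norm $\|(x,y)\|=\max\{\|x\|,\|y\|\}$. For a normed space $X$, $\mathrm{MIN}(X)$ is $X$ with the matrix norms $\|(x_{ij})\|_{M_k(\mathrm{MIN}(X))}=\sup\{\|(f(x_{ij}))\|_{\ell_2^k\to\ell_2^k}: f\in X^*,\ \|f\|\le1\}$. *)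

theory Defs
  imports "HOL-Analysis.Analysis"
begin

definition tetrablock :: "(complex^3) set" where
  "tetrablock = {x. \<forall>z\<in>cball 0 1. \<forall>w\<in>cball 0 1. 1 - x$1 * z - x$2 * w + x$3 * z * w \<noteq> 0}"

(* The norm on complex^'k is Euclidean, so this is the norm of A as an operator on l_2^k. *)
definition op_norm :: "complex^'k^'k \<Rightarrow> real" where
  "op_norm A = onorm (\<lambda>v. A *v v)"


section \<open>Matrices of rational functions\<close>

(* Exponents of monomials are functions \<alpha> :: 'm \<Rightarrow> nat. *)
definition is_poly_fun :: "(complex^'m \<Rightarrow> complex) \<Rightarrow> bool" where
  "is_poly_fun p \<longleftrightarrow> (\<exists>A c. finite A \<and> p = (\<lambda>z. \<Sum>\<alpha>\<in>A. c \<alpha> * (\<Prod>i\<in>UNIV. (z$i) ^ \<alpha> i)))"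

(* A rational function is represented as a total function. Its values at zeros of q, which lie
   outside \<Omega>, are irrelevant: only values and derivatives at points of \<Omega> are used. *)
definition rat_funs :: "(complex^'m) set \<Rightarrow> (complex^'m \<Rightarrow> complex) set" where
  "rat_funs \<Omega> = {f. \<exists>p q. is_poly_fun p \<and> is_poly_fun q \<and> (\<forall>z\<in>\<Omega>. q z \<noteq> 0) \<and> f = (\<lambda>z. p z / q z)}"

definition rat_matrices :: "(complex^'m) set \<Rightarrow> (complex^'m \<Rightarrow> complex^'k^'k) set" where
  "rat_matrices \<Omega> = {F. \<forall>i j. (\<lambda>z. F z $ i $ j) \<in> rat_funs \<Omega>}"

(* For compact nonempty \<Omega> and F in rat_matrices \<Omega> the set of values is bounded and nonempty,
   so this is the genuine supremum. *)
definition rat_norm :: "(complex^'m) set \<Rightarrow> (complex^'m \<Rightarrow> complex^'k^'k) \<Rightarrow> real" where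
  "rat_norm \<Omega> F = (SUP z\<in>\<Omega>. op_norm (F z))"


section \<open>The cotangent operator space\<close>

definition partial_deriv :: "'m \<Rightarrow> (complex^'m \<Rightarrow> complex) \<Rightarrow> complex^'m \<Rightarrow> complex" where
  "partial_deriv r f w = deriv (\<lambda>t. f (w + axis r t)) 0"

definition D_mat :: "(complex^'m \<Rightarrow> complex^'k^'k) \<Rightarrow> complex^'m \<Rightarrow> (complex^'k^'k)^'m" where
  "D_mat F w = (\<chi> r. \<chi> i j. partial_deriv r (\<lambda>z. F z $ i $ j) w)"

(* (B_1, ..., B_m) is sent to the sum of the B_r \<otimes> e_r, a matrix with entries in complex^'m. *)
definition tuple_to_mat :: "('a^'k^'k)^'m \<Rightarrow> ('a^'m)^'k^'k" where
  "tuple_to_mat B = (\<chi> i j. \<chi> r. B $ r $ i $ j)"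

definition cot_ball :: "(complex^'m) set \<Rightarrow> complex^'m \<Rightarrow> ((complex^'m)^'k^'k) set" where
  "cot_ball \<Omega> w = closure (tuple_to_mat `
     {D_mat F w | F. F \<in> rat_matrices \<Omega> \<and> rat_norm \<Omega> F \<le> 1 \<and> F w = 0})"

(* The norm with closed unit ball cot_ball, given as the Minkowski functional of that set;
   cf. cot_norm_unique. *)
definition cot_norm :: "(complex^'m) set \<Rightarrow> complex^'m \<Rightarrow> (complex^'m)^'k^'k \<Rightarrow> real" where
  "cot_norm \<Omega> w B = Inf {t. t > 0 \<and> (1 / t) *\<^sub>R B \<in> cot_ball \<Omega> w}"

lemma cot_norm_unique:
  fixes N :: "(complex^'m)^'k^'k \<Rightarrow> real"
  assumes nonneg: "\<And>B. N B \<ge> 0"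
    and hom: "\<And>t B. N (t *\<^sub>R B) = \<bar>t\<bar> * N B"
    and ball: "cot_ball \<Omega> w = {B. N B \<le> 1}"
  shows "cot_norm \<Omega> w B = N B"
proof -
  have eq: "{t. t > 0 \<and> (1 / t) *\<^sub>R B \<in> cot_ball \<Omega> w} = {t. t > 0 \<and> N B \<le> t}"
    unfolding ball by (auto simp: hom field_simps)
  have "Inf {t. t > 0 \<and> N B \<le> t} = N B"
  proof (cases "N B = 0")
    case True
    then have "{t. t > 0 \<and> N B \<le> t} = {0<..}" by auto
    then show ?thesis using True by simp
  next
    case False
    with nonneg[of B] have "N B > 0" by simp
    then have "{t. t > 0 \<and> N B \<le> t} = {N B..}" by auto
    then show ?thesis by simp
  qed
  with eq show ?thesis by (simp add: cot_norm_def)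
qed


section \<open>MIN operator spaces\<close>

(* A complex normed space is given by a type 'x, its scalar multiplication s and its norm N. *)
definition dual_ball :: "(complex \<Rightarrow> 'x \<Rightarrow> 'x) \<Rightarrow> ('x::ab_group_add \<Rightarrow> real) \<Rightarrow> ('x \<Rightarrow> complex) set" where
  "dual_ball s N = {f. Vector_Spaces.linear s (*) f \<and> (\<forall>x. N x \<le> 1 \<longrightarrow> cmod (f x) \<le> 1)}"

definition min_norm ::
  "(complex \<Rightarrow> 'x \<Rightarrow> 'x) \<Rightarrow> ('x::ab_group_add \<Rightarrow> real) \<Rightarrow> 'x^'k^'k \<Rightarrow> real" where
  "min_norm s N X = (SUP f\<in>dual_ball s N. op_norm (map_matrix f X))"

definition l1_norm :: "complex^'n \<Rightarrow> real" where
  "l1_norm x = (\<Sum>i\<in>UNIV. cmod (x $ i))"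

definition dsum_inf_norm :: "('x \<Rightarrow> real) \<Rightarrow> ('y \<Rightarrow> real) \<Rightarrow> 'x \<times> 'y \<Rightarrow> real" where
  "dsum_inf_norm N1 N2 p = max (N1 (fst p)) (N2 (snd p))"

definition l1_sum_norm :: "(complex^2) \<times> complex \<Rightarrow> real" where
  "l1_sum_norm = dsum_inf_norm l1_norm cmod"

definition l1_sum_scale :: "complex \<Rightarrow> (complex^2) \<times> complex \<Rightarrow> (complex^2) \<times> complex" where
  "l1_sum_scale = module_prod.scale (*s) (*)"

definition ident :: "complex^3 \<Rightarrow> (complex^2) \<times> complex" where
  "ident c = (vector [c$1, c$2], c$3)"

end

theory Submission
  imports Defs "HOL-Complex_Analysis.Conformal_Mappings"
begin

text \<open>
Write \<open>B = (B\<^sub>1, B\<^sub>2, B\<^sub>3)\<close> for the three coefficient matrices. The dual ball of \<open>\<ell>\<^sub>1\<^sup>2 \<oplus>\<^sub>\<infinity> \<complex>\<close> consists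
of the functionals \<open>(a, b, c)\<close> with \<open>max \<bar>a\<bar> \<bar>b\<bar> + \<bar>c\<bar> \<le> 1\<close>, so \<open>B\<close> has minimal norm at most \<open>1\<close> if and only if
\<open>\<parallel>a B\<^sub>1 + b B\<^sub>2\<parallel> \<le> 1\<close> for all \<open>\<bar>a\<bar>, \<bar>b\<bar> \<le> 1\<close> and \<open>\<parallel>B\<^sub>3\<parallel> \<le> 1\<close> (\<open>min_norm_le_1_iff\<close>). The theorem says that these
\<open>B\<close> form the cotangent unit ball (\<open>cot_ball_tetrablock\<close>).

Derivatives of contractive functions satisfy the two bounds because the discs \<open>t \<mapsto> (a t, b t, a b t\<^sup>2)\<close> and
\<open>t \<mapsto> (0, 0, t)\<close> lie in the closed tetrablock: apply the Schwarz lemma along them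
(\<open>unit_ball_derivative_pencil\<close>).

Conversely, let \<open>B\<close> satisfy the bounds, with \<open>\<parallel>B\<^sub>3\<parallel> < 1\<close> after scaling. An explicit rational function has
derivative \<open>B\<close> at the origin:
\<open>F x = x\<^sub>1 B\<^sub>1 + x\<^sub>2 B\<^sub>2 + (x\<^sub>3 - x\<^sub>1 x\<^sub>2) B\<^sub>3 (1 + (x\<^sub>2 B\<^sub>1\<^sup>* + x\<^sub>1 B\<^sub>2\<^sup>*) B\<^sub>3)\<^sup>-\<^sup>1\<close>.
It remains to see that \<open>F\<close> is contractive on the closed tetrablock. Through every point of the tetrablock
there is an analytic disc whose boundary lies in the set \<open>x\<^sub>1 = cnj x\<^sub>2 x\<^sub>3\<close>, \<open>\<bar>x\<^sub>3\<bar> = 1\<close>, \<open>\<bar>x\<^sub>2\<bar> \<le> 1\<close>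
(\<open>tetrablock_disc\<close>), so by the maximum principle it suffices to bound \<open>F\<close> there. On that set
\<open>K = x\<^sub>1 B\<^sub>1 + x\<^sub>2 B\<^sub>2\<close> has norm at most \<open>\<bar>x\<^sub>2\<bar>\<close>, and with \<open>C = x\<^sub>3 B\<^sub>3\<close> the formula becomes
\<open>F x = K + (1 - \<bar>x\<^sub>2\<bar>\<^sup>2) C (1 + K\<^sup>* C)\<^sup>-\<^sup>1\<close>, an operator Moebius transform of the contraction \<open>C\<close>, which is
again a contraction (\<open>halmos_contraction\<close>).
\<close>

section \<open>Hermitian form and operator norm\<close>

definition herm :: "complex^'n \<Rightarrow> complex^'n \<Rightarrow> complex" where
  "herm v y = (\<Sum>i\<in>UNIV. cnj (v$i) * y$i)"

lemma herm_self: "herm v v = of_real ((norm v)\<^sup>2)"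
proof -
  have "(norm v)\<^sup>2 = (\<Sum>i\<in>UNIV. (norm (v$i))\<^sup>2)"
    by (simp add: norm_vec_def L2_set_def sum_nonneg)
  moreover have "cnj a * a = of_real ((norm a)\<^sup>2)" for a
    by (metis complex_norm_square mult.commute)
  ultimately show ?thesis by (simp only: herm_def of_real_sum)
qed

lemma cmod_herm_le: "cmod (herm v y) \<le> norm v * norm y"
proof -
  have "cmod (herm v y) \<le> (\<Sum>i\<in>UNIV. \<bar>norm (v$i)\<bar> * \<bar>norm (y$i)\<bar>)"
    unfolding herm_def by (rule order_trans[OF norm_sum]) (simp add: norm_mult)
  also have "\<dots> \<le> norm v * norm y"
    unfolding norm_vec_def by (rule L2_set_mult_ineq)
  finally show ?thesis .
qed

text \<open>This reduces norm bounds on vector-valued holomorphic functions to scalar ones, for which Cauchy's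
estimate and the maximum principle are available.\<close>

lemma norm_le_if_herm_le:
  fixes y :: "complex^'n"
  assumes "\<And>v. cmod (herm v y) \<le> norm v * b"
  shows "norm y \<le> b"
proof (cases "y = 0")
  case True
  have "0 \<le> norm (axis undefined 1 :: complex^'n) * b"
    by (rule order_trans[OF norm_ge_zero assms])
  then show ?thesis using True by (simp add: zero_le_mult_iff)
next
  case False
  have "norm y * norm y \<le> norm y * b"
    using assms[of y] by (simp add: herm_self power2_eq_square norm_mult)
  then show ?thesis using False by simp
qed

lemma op_norm_le_1_iff: "op_norm A \<le> 1 \<longleftrightarrow> (\<forall>u. norm (A *v u) \<le> norm u)"
proof
  assume *: "op_norm A \<le> 1"
  show "\<forall>u. norm (A *v u) \<le> norm u"
  proof
    fix u
    have "norm (A *v u) \<le> op_norm A * norm u"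
      unfolding op_norm_def by (rule onorm) simp
    also have "\<dots> \<le> 1 * norm u" using * by (intro mult_right_mono) auto
    finally show "norm (A *v u) \<le> norm u" by simp
  qed
next
  assume "\<forall>u. norm (A *v u) \<le> norm u"
  then show "op_norm A \<le> 1"
    unfolding op_norm_def by (intro onorm_bound) auto
qed

lemma op_norm_nonneg: "0 \<le> op_norm A"
  unfolding op_norm_def by (rule onorm_pos_le) simp

lemma op_norm_le_sum_entries: "op_norm A \<le> (\<Sum>i\<in>UNIV. \<Sum>j\<in>UNIV. cmod (A$i$j))"
  unfolding op_norm_def
proof (rule onorm_bound)
  fix u
  have "norm (A *v u) \<le> (\<Sum>i\<in>UNIV. cmod ((A *v u)$i))"
    unfolding norm_vec_def by (rule L2_set_le_sum) simp
  also have "\<dots> \<le> (\<Sum>i\<in>UNIV. \<Sum>j\<in>UNIV. cmod (A$i$j) * norm u)"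
  proof (rule sum_mono)
    fix i
    have "cmod ((A *v u)$i) \<le> (\<Sum>j\<in>UNIV. cmod (A$i$j * u$j))"
      unfolding matrix_vector_mult_def vec_lambda_beta by (rule norm_sum)
    also have "\<dots> \<le> (\<Sum>j\<in>UNIV. cmod (A$i$j) * norm u)"
      unfolding norm_mult by (intro sum_mono mult_left_mono Finite_Cartesian_Product.norm_nth_le) auto
    finally show "cmod ((A *v u)$i) \<le> (\<Sum>j\<in>UNIV. cmod (A$i$j) * norm u)" .
  qed
  finally show "norm (A *v u) \<le> (\<Sum>i\<in>UNIV. \<Sum>j\<in>UNIV. cmod (A$i$j)) * norm u"
    by (simp add: sum_distrib_right)
qed (simp add: sum_nonneg)

lemma scaleR_matrix_vector_mult: "(t *\<^sub>R A) *v (u :: complex^'n) = t *\<^sub>R (A *v u)"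
  by (simp add: vec_eq_iff matrix_vector_mult_def scaleR_sum_right)

lemma op_norm_scaleR: "op_norm (t *\<^sub>R A) = \<bar>t\<bar> * op_norm A"
proof -
  have "(*v) (t *\<^sub>R A) = (\<lambda>u. t *\<^sub>R (A *v u))"
    by (rule ext) (rule scaleR_matrix_vector_mult)
  then show ?thesis unfolding op_norm_def by (simp add: onorm_scaleR)
qed

definition ctrans :: "complex^'n^'m \<Rightarrow> complex^'m^'n" where
  "ctrans A = (\<chi> i j. cnj (A$j$i))"

lemma inner_eq_Re_herm: "v \<bullet> y = Re (herm v y)"
  by (simp add: inner_vec_def herm_def inner_complex_def)

lemma herm_ctrans: "herm (A *v u) w = herm u (ctrans A *v w)"
proof -
  have "herm (A *v u) w = (\<Sum>i\<in>UNIV. \<Sum>j\<in>UNIV. cnj (A$i$j) * cnj (u$j) * w$i)"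
    by (simp add: herm_def matrix_vector_mult_def sum_distrib_right)
  also have "\<dots> = (\<Sum>j\<in>UNIV. \<Sum>i\<in>UNIV. cnj (A$i$j) * cnj (u$j) * w$i)"
    by (rule sum.swap)
  also have "\<dots> = herm u (ctrans A *v w)"
    unfolding herm_def matrix_vector_mult_def ctrans_def by (simp add: sum_distrib_left mult_ac)
  finally show ?thesis .
qed

lemma inner_ctrans: "(A *v u) \<bullet> w = u \<bullet> (ctrans A *v w)"
  by (simp only: inner_eq_Re_herm herm_ctrans)

lemma norm_ctrans_le:
  fixes A :: "complex^'n^'m"
  assumes "\<And>u. norm (A *v u) \<le> b * norm u"
  shows "norm (ctrans A *v w) \<le> b * norm w"
proof -
  let ?y = "ctrans A *v w"
  have "norm ?y * norm ?y = (A *v ?y) \<bullet> w"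
    by (simp add: inner_ctrans dot_square_norm power2_eq_square)
  also have "\<dots> \<le> norm (A *v ?y) * norm w" by (rule norm_cauchy_schwarz)
  also have "\<dots> \<le> b * norm ?y * norm w" using assms by (intro mult_right_mono) auto
  finally have le: "norm ?y * norm ?y \<le> norm ?y * (b * norm w)" by (simp add: ac_simps)
  show ?thesis
  proof (cases "?y = 0")
    case True
    have "0 \<le> b * norm (axis undefined 1 :: complex^'n)"
      by (rule order_trans[OF norm_ge_zero assms])
    then show ?thesis using True by (simp add: zero_le_mult_iff)
  next
    case False
    then show ?thesis using le by simp
  qed
qed

text \<open>With \<open>\<sigma> = sqrt (1 - r\<^sup>2)\<close>, the block matrix with rows \<open>(K, \<sigma>)\<close> and \<open>(\<sigma>, -K\<^sup>*)\<close> is a contraction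
when \<open>\<parallel>K\<parallel> \<le> r\<close>, because its columns are orthogonal. It maps \<open>(u, \<sigma> c)\<close> to
\<open>(K u + \<sigma>\<^sup>2 c, \<sigma> (u - K\<^sup>* c)) = (K u + \<sigma>\<^sup>2 c, \<sigma> y)\<close>. The second component does not shrink, since
\<open>\<parallel>c\<parallel> \<le> \<parallel>y\<parallel>\<close>; hence the first one does not grow. The proof below writes \<open>s\<close> for \<open>\<sigma>\<^sup>2\<close>.\<close>

lemma halmos_contraction:
  fixes K :: "complex^'n^'m"
  assumes K: "\<And>u. norm (K *v u) \<le> r * norm u" and r: "0 \<le> r" "r \<le> 1"
    and c: "norm c \<le> norm y" and u: "u = y + ctrans K *v c"
  shows "norm (K *v u + (1 - r\<^sup>2) *\<^sub>R c) \<le> norm u"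
proof -
  define s where "s = 1 - r\<^sup>2"
  have s: "s \<ge> 0" unfolding s_def using r by (simp add: power_le_one)
  let ?w = "ctrans K *v c"
  have y: "y = u - ?w" using u by simp
  have sq: "(norm (K *v u + s *\<^sub>R c))\<^sup>2 = (norm (K *v u))\<^sup>2 + 2 * s * ((K *v u) \<bullet> c) + s\<^sup>2 * (norm c)\<^sup>2"
    unfolding power2_norm_eq_inner
    by (simp add: inner_add_left inner_add_right inner_commute[of c "K *v u"] distrib_left
        power2_eq_square)
  have ny: "(norm y)\<^sup>2 = (norm u)\<^sup>2 - 2 * (u \<bullet> ?w) + (norm ?w)\<^sup>2"
    unfolding y power2_norm_eq_inner
    by (simp add: inner_diff_left inner_diff_right inner_commute[of ?w u])
  have Ku: "(norm (K *v u))\<^sup>2 \<le> r\<^sup>2 * (norm u)\<^sup>2"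
    using power_mono[OF K[of u], of 2] by (simp add: power_mult_distrib)
  have w: "(norm ?w)\<^sup>2 \<le> r\<^sup>2 * (norm c)\<^sup>2"
    using power_mono[OF norm_ctrans_le[OF K, of c], of 2] by (simp add: power_mult_distrib)
  have "(norm (K *v u + s *\<^sub>R c))\<^sup>2 + s * (norm y)\<^sup>2
      = (norm (K *v u))\<^sup>2 + s\<^sup>2 * (norm c)\<^sup>2 + s * (norm u)\<^sup>2 + s * (norm ?w)\<^sup>2"
    unfolding sq ny by (simp add: inner_ctrans algebra_simps)
  also have "\<dots> \<le> r\<^sup>2 * (norm u)\<^sup>2 + s\<^sup>2 * (norm c)\<^sup>2 + s * (norm u)\<^sup>2 + s * (r\<^sup>2 * (norm c)\<^sup>2)"
    by (intro add_mono mult_left_mono Ku w s order_refl)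
  also have "\<dots> = (norm u)\<^sup>2 + s * (norm c)\<^sup>2"
    unfolding s_def by (simp add: algebra_simps power2_eq_square)
  also have "\<dots> \<le> (norm u)\<^sup>2 + s * (norm y)\<^sup>2"
    using c s by (intro add_left_mono mult_left_mono power_mono) auto
  finally have "(norm (K *v u + s *\<^sub>R c))\<^sup>2 \<le> (norm u)\<^sup>2"
    by (simp only: add_le_cancel_right)
  then show ?thesis unfolding s_def by (rule power2_le_imp_le) simp
qed

section \<open>Polynomial and rational functions\<close>

text \<open>The exponents need not be distinct here, in contrast to the definition of polynomial functions.
Sums and products of polynomials come in this form.\<close>

lemma is_poly_fun_monomial_family:
  fixes \<alpha> :: "'i \<Rightarrow> 'm::finite \<Rightarrow> nat"
  assumes "finite I"
  shows "is_poly_fun (\<lambda>z. \<Sum>i\<in>I. c i * (\<Prod>r\<in>UNIV. (z$r) ^ \<alpha> i r))"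
proof -
  have "(\<Sum>i\<in>I. c i * (\<Prod>r\<in>UNIV. (z$r) ^ \<alpha> i r))
      = (\<Sum>\<beta>\<in>\<alpha> ` I. (\<Sum>i\<in>{i\<in>I. \<alpha> i = \<beta>}. c i) * (\<Prod>r\<in>UNIV. (z$r) ^ \<beta> r))" for z :: "complex^'m"
    unfolding sum_distrib_right sum.image_gen[OF assms, of _ \<alpha>] by (intro sum.cong) auto
  then show ?thesis
    unfolding is_poly_fun_def using assms by (intro exI[of _ "\<alpha> ` I"] exI) auto
qed

lemma is_poly_fun_const: "is_poly_fun (\<lambda>z. a)"
  using is_poly_fun_monomial_family[of "{()}" "\<lambda>_. a" "\<lambda>_ _. 0"] by simp

lemma is_poly_fun_coord: "is_poly_fun (\<lambda>z::complex^'m. z$i)"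
proof -
  have "(\<Prod>r\<in>UNIV. (z$r) ^ (if r = i then 1 else 0)) = z$i" for z :: "complex^'m"
    by (subst prod.cong[OF refl, of _ _ "\<lambda>r. if r = i then z$r else 1"]) auto
  then show ?thesis
    using is_poly_fun_monomial_family[of "{()}" "\<lambda>_. 1" "\<lambda>_ r. if r = i then 1 else 0 :: nat"] by simp
qed

lemma is_poly_fun_add:
  assumes "is_poly_fun p" "is_poly_fun q"
  shows "is_poly_fun (\<lambda>z. p z + q z)"
proof -
  obtain A c where A: "finite A" "p = (\<lambda>z. \<Sum>\<alpha>\<in>A. c \<alpha> * (\<Prod>i\<in>UNIV. (z$i) ^ \<alpha> i))"
    using assms(1) unfolding is_poly_fun_def by blast
  obtain B d where B: "finite B" "q = (\<lambda>z. \<Sum>\<alpha>\<in>B. d \<alpha> * (\<Prod>i\<in>UNIV. (z$i) ^ \<alpha> i))"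
    using assms(2) unfolding is_poly_fun_def by blast
  have "p z + q z = (\<Sum>s\<in>A <+> B. case_sum c d s * (\<Prod>i\<in>UNIV. (z$i) ^ case_sum id id s i))" for z
    using A B by (simp add: sum.Plus)
  then show ?thesis
    using is_poly_fun_monomial_family[of "A <+> B"] A(1) B(1) by simp
qed

lemma is_poly_fun_mult:
  assumes "is_poly_fun p" "is_poly_fun q"
  shows "is_poly_fun (\<lambda>z. p z * q z)"
proof -
  obtain A c where A: "finite A" "p = (\<lambda>z. \<Sum>\<alpha>\<in>A. c \<alpha> * (\<Prod>i\<in>UNIV. (z$i) ^ \<alpha> i))"
    using assms(1) unfolding is_poly_fun_def by blast
  obtain B d where B: "finite B" "q = (\<lambda>z. \<Sum>\<alpha>\<in>B. d \<alpha> * (\<Prod>i\<in>UNIV. (z$i) ^ \<alpha> i))"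
    using assms(2) unfolding is_poly_fun_def by blast
  have "p z * q z = (\<Sum>s\<in>A \<times> B. (c (fst s) * d (snd s)) * (\<Prod>i\<in>UNIV. (z$i) ^ (fst s i + snd s i)))" for z
    by (simp add: A(2) B(2) sum_product sum.cartesian_product power_add prod.distrib case_prod_beta ac_simps)
  then show ?thesis
    using is_poly_fun_monomial_family[of "A \<times> B"] A(1) B(1) by simp
qed

lemma is_poly_fun_diff: "is_poly_fun p \<Longrightarrow> is_poly_fun q \<Longrightarrow> is_poly_fun (\<lambda>z. p z - q z)"
  using is_poly_fun_add[OF _ is_poly_fun_mult[OF is_poly_fun_const[of "-1"]], of p q] by simp

lemma is_poly_fun_sum: "(\<And>i. i \<in> I \<Longrightarrow> is_poly_fun (p i)) \<Longrightarrow> is_poly_fun (\<lambda>z. \<Sum>i\<in>I. p i z)"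
  by (induction I rule: infinite_finite_induct) (auto intro: is_poly_fun_const is_poly_fun_add)

lemma is_poly_fun_prod: "(\<And>i. i \<in> I \<Longrightarrow> is_poly_fun (p i)) \<Longrightarrow> is_poly_fun (\<lambda>z. \<Prod>i\<in>I. p i z)"
  by (induction I rule: infinite_finite_induct) (auto intro: is_poly_fun_const is_poly_fun_mult)

lemma is_poly_fun_det:
  "(\<And>i j. is_poly_fun (\<lambda>z. M z $ i $ j)) \<Longrightarrow> is_poly_fun (\<lambda>z. det (M z))"
  unfolding det_def by (intro is_poly_fun_sum is_poly_fun_mult is_poly_fun_const is_poly_fun_prod)

lemmas is_poly_fun_intros = is_poly_fun_const is_poly_fun_coord is_poly_fun_add is_poly_fun_mult
  is_poly_fun_diff is_poly_fun_sum is_poly_fun_prod is_poly_fun_det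

lemma poly_fun_holomorphic_compose:
  assumes "is_poly_fun p" "\<And>r. (\<lambda>t. d t $ r) holomorphic_on S"
  shows "(\<lambda>t. p (d t)) holomorphic_on S"
proof -
  obtain A c where A: "p = (\<lambda>z. \<Sum>\<alpha>\<in>A. c \<alpha> * (\<Prod>i\<in>UNIV. (z$i) ^ \<alpha> i))"
    using assms(1) unfolding is_poly_fun_def by blast
  show ?thesis unfolding A by (intro holomorphic_intros assms)
qed

lemma poly_fun_continuous_on: "is_poly_fun p \<Longrightarrow> continuous_on S p"
  unfolding is_poly_fun_def by (auto intro!: continuous_intros)

lemma rat_funs_iff:
  "f \<in> rat_funs \<Omega> \<longleftrightarrow>
    (\<exists>p q. is_poly_fun p \<and> is_poly_fun q \<and> (\<forall>z\<in>\<Omega>. q z \<noteq> 0) \<and> (\<forall>z. f z = p z / q z))"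
  unfolding rat_funs_def mem_Collect_eq fun_eq_iff ..

lemma rat_fun_holomorphic_compose:
  assumes "f \<in> rat_funs \<Omega>" "\<And>r. (\<lambda>t. d t $ r) holomorphic_on S" "d ` S \<subseteq> \<Omega>"
  shows "(\<lambda>t. f (d t)) holomorphic_on S"
proof -
  obtain p q where pq: "is_poly_fun p" "is_poly_fun q" "\<forall>z\<in>\<Omega>. q z \<noteq> 0" "\<forall>z. f z = p z / q z"
    using assms(1) unfolding rat_funs_iff by (elim exE conjE) (rule that)
  have "(\<lambda>t. p (d t) / q (d t)) holomorphic_on S"
    using pq(3) assms(3)
    by (intro holomorphic_on_divide poly_fun_holomorphic_compose[OF pq(1) assms(2)]
        poly_fun_holomorphic_compose[OF pq(2) assms(2)]) auto
  then show ?thesis using pq(4) by simp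
qed

lemma rat_fun_continuous_on:
  assumes "f \<in> rat_funs \<Omega>"
  shows "continuous_on \<Omega> f"
proof -
  obtain p q where pq: "is_poly_fun p" "is_poly_fun q" "\<forall>z\<in>\<Omega>. q z \<noteq> 0" "\<forall>z. f z = p z / q z"
    using assms(1) unfolding rat_funs_iff by (elim exE conjE) (rule that)
  have "continuous_on \<Omega> (\<lambda>z. p z / q z)"
    by (intro continuous_on_divide poly_fun_continuous_on pq(1-3))
  then show ?thesis using pq(4) by (simp cong: continuous_on_cong)
qed

text \<open>Differentiability is tested along holomorphic curves: this is what restricting a function to a disc
needs, and the rules for sums and products reduce to those of one variable.\<close>

definition has_gradient :: "(complex^'m \<Rightarrow> complex) \<Rightarrow> complex^'m \<Rightarrow> complex^'m \<Rightarrow> bool" where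
  "has_gradient f G w \<longleftrightarrow> (\<forall>d e. d 0 = w \<and> (\<forall>r. ((\<lambda>t. d t $ r) has_field_derivative e r) (at 0))
     \<longrightarrow> ((\<lambda>t. f (d t)) has_field_derivative (\<Sum>r\<in>UNIV. G$r * e r)) (at 0))"

lemma has_gradientD:
  assumes "has_gradient f G w" "d 0 = w" "\<And>r. ((\<lambda>t. d t $ r) has_field_derivative e r) (at 0)"
  shows "((\<lambda>t. f (d t)) has_field_derivative (\<Sum>r\<in>UNIV. G$r * e r)) (at 0)"
  using assms(1)[unfolded has_gradient_def, rule_format, of d e] assms(2,3) by blast

lemma has_gradient_const: "has_gradient (\<lambda>z. a) 0 w"
  by (auto simp: has_gradient_def)

lemma has_gradient_coord: "has_gradient (\<lambda>z. z$i) (axis i 1) w"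
proof -
  have "(\<Sum>r\<in>UNIV. axis i 1 $ r * e r) = e i" for e :: "'a \<Rightarrow> complex"
    by (subst sum.cong[OF refl, of _ _ "\<lambda>r. if r = i then e r else 0"]) (auto simp: axis_def)
  then show ?thesis by (auto simp: has_gradient_def)
qed

lemma has_gradient_add:
  "has_gradient f G w \<Longrightarrow> has_gradient g H w \<Longrightarrow> has_gradient (\<lambda>z. f z + g z) (G + H) w"
  unfolding has_gradient_def by (auto simp: distrib_right sum.distrib intro!: DERIV_add)

lemma has_gradient_mult:
  assumes "has_gradient f G w" "has_gradient g H w"
  shows "has_gradient (\<lambda>z. f z * g z) (g w *s G + f w *s H) w"
  unfolding has_gradient_def
proof (intro allI impI)
  fix d e assume d: "d 0 = w \<and> (\<forall>r. ((\<lambda>t. d t $ r) has_field_derivative e r) (at 0))"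
  have "((\<lambda>t. f (d t)) has_field_derivative (\<Sum>r\<in>UNIV. G$r * e r)) (at 0)"
    "((\<lambda>t. g (d t)) has_field_derivative (\<Sum>r\<in>UNIV. H$r * e r)) (at 0)"
    using assms d unfolding has_gradient_def by blast+
  from DERIV_mult[OF this]
  show "((\<lambda>t. f (d t) * g (d t)) has_field_derivative
      (\<Sum>r\<in>UNIV. (g w *s G + f w *s H)$r * e r)) (at 0)"
    using d by (simp add: sum_distrib_left distrib_left distrib_right sum.distrib mult_ac add_ac)
qed

lemma has_gradient_divide:
  assumes "has_gradient f G w" "has_gradient g H w" "g w \<noteq> 0"
  shows "has_gradient (\<lambda>z. f z / g z) ((1 / g w) *s G - (f w / (g w)\<^sup>2) *s H) w"
  unfolding has_gradient_def
proof (intro allI impI)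
  fix d e assume d: "d 0 = w \<and> (\<forall>r. ((\<lambda>t. d t $ r) has_field_derivative e r) (at 0))"
  have "((\<lambda>t. f (d t)) has_field_derivative (\<Sum>r\<in>UNIV. G$r * e r)) (at 0)"
    "((\<lambda>t. g (d t)) has_field_derivative (\<Sum>r\<in>UNIV. H$r * e r)) (at 0)"
    using assms d unfolding has_gradient_def by blast+
  from DERIV_divide[OF this]
  have "((\<lambda>t. f (d t) / g (d t)) has_field_derivative
    ((\<Sum>r\<in>UNIV. G$r * e r) * g w - f w * (\<Sum>r\<in>UNIV. H$r * e r)) / (g w * g w)) (at 0)"
    using d assms(3) by simp
  moreover have "(a * g w - f w * b) / (g w * g w) = (1 / g w) * a - (f w / (g w)\<^sup>2) * b" for a b
    using assms(3) by (simp add: field_simps power2_eq_square)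
  moreover have "(1 / g w) * (\<Sum>r\<in>UNIV. G$r * e r) - (f w / (g w)\<^sup>2) * (\<Sum>r\<in>UNIV. H$r * e r)
      = (\<Sum>r\<in>UNIV. ((1 / g w) *s G - (f w / (g w)\<^sup>2) *s H)$r * e r)"
    unfolding sum_distrib_left sum_subtractf[symmetric]
    by (intro sum.cong) (auto simp: left_diff_distrib)
  ultimately show "((\<lambda>t. f (d t) / g (d t)) has_field_derivative
      (\<Sum>r\<in>UNIV. ((1 / g w) *s G - (f w / (g w)\<^sup>2) *s H)$r * e r)) (at 0)"
    by metis
qed

lemma poly_fun_has_gradient:
  assumes "is_poly_fun p"
  shows "\<exists>G. has_gradient p G w"
proof -
  obtain A c where A: "p = (\<lambda>z. \<Sum>\<alpha>\<in>A. c \<alpha> * (\<Prod>i\<in>UNIV. (z$i) ^ \<alpha> i))"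
    using assms unfolding is_poly_fun_def by blast
  have pow: "\<exists>G. has_gradient (\<lambda>z. (z$i) ^ n) G w" for i :: 'a and n
    by (induction n) (auto intro: has_gradient_const has_gradient_mult[OF has_gradient_coord])
  have mono: "\<exists>G. has_gradient (\<lambda>z. \<Prod>i\<in>I. (z$i) ^ \<alpha> i) G w" for I :: "'a set" and \<alpha>
  proof (induction I rule: infinite_finite_induct)
    case (insert i I)
    then show ?case using has_gradient_mult pow by simp blast
  qed (auto intro: has_gradient_const)
  show ?thesis unfolding A
  proof (induction A rule: infinite_finite_induct)
    case (insert \<alpha> A)
    obtain G where "has_gradient (\<lambda>z. \<Prod>i\<in>UNIV. (z$i) ^ \<alpha> i) G w" using mono by blast
    from has_gradient_add[OF has_gradient_mult[OF has_gradient_const this]] insert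
    show ?case by simp blast
  qed (auto intro: has_gradient_const)
qed

lemma rat_fun_has_gradient:
  assumes "f \<in> rat_funs \<Omega>" "w \<in> \<Omega>"
  shows "has_gradient f (\<chi> r. partial_deriv r f w) w"
proof -
  obtain p q where pq: "is_poly_fun p" "is_poly_fun q" "\<forall>z\<in>\<Omega>. q z \<noteq> 0" "\<forall>z. f z = p z / q z"
    using assms(1) unfolding rat_funs_iff by (elim exE conjE) (rule that)
  have f: "f = (\<lambda>z. p z / q z)" using pq(4) by (simp add: fun_eq_iff)
  obtain P Q where PQ: "has_gradient p P w" "has_gradient q Q w"
    using poly_fun_has_gradient[OF pq(1)] poly_fun_has_gradient[OF pq(2)] by metis
  have "q w \<noteq> 0" using pq(3) assms(2) by simp
  define G where "G = (1 / q w) *s P - (p w / (q w)\<^sup>2) *s Q"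
  have G: "has_gradient f G w"
    unfolding f G_def by (rule has_gradient_divide) fact+
  have "partial_deriv r f w = G$r" for r
  proof -
    have "((\<lambda>t. (w + axis r t) $ s) has_field_derivative (if s = r then 1 else 0)) (at 0)" for s
      by (auto simp: axis_def intro!: derivative_eq_intros)
    moreover have "w + axis r 0 = w" by (simp add: axis_def vec_eq_iff)
    ultimately have "((\<lambda>t. f (w + axis r t)) has_field_derivative
       (\<Sum>s\<in>UNIV. G$s * (if s = r then 1 else 0))) (at 0)"
      using has_gradientD[OF G, of "\<lambda>t. w + axis r t" "\<lambda>s. if s = r then 1 else 0"] by simp
    then show ?thesis
      unfolding partial_deriv_def by (intro DERIV_imp_deriv) (simp add: if_distrib cong: if_cong)
  qed
  then have "(\<chi> r. partial_deriv r f w) = G" by (simp add: vec_eq_iff)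
  then show ?thesis using G by simp
qed

text \<open>The matrix-valued Schwarz lemma, in the form of Cauchy's estimate for the scalar functions
\<open>t \<mapsto> \<langle>F (d t) u, v\<rangle>\<close> along an analytic disc \<open>d\<close> in \<open>\<Omega>\<close> with derivative \<open>e\<close> at its centre.\<close>

lemma matrix_schwarz:
  fixes F :: "complex^'m \<Rightarrow> complex^'k^'k"
  assumes F: "F \<in> rat_matrices \<Omega>" and le: "\<And>z u. z \<in> \<Omega> \<Longrightarrow> norm (F z *v u) \<le> norm u"
    and d: "\<And>r. (\<lambda>t. d t $ r) holomorphic_on UNIV" "d ` cball 0 1 \<subseteq> \<Omega>"
      "\<And>r. ((\<lambda>t. d t $ r) has_field_derivative e r) (at 0)"
  shows "norm ((\<chi> i j. \<Sum>r\<in>UNIV. tuple_to_mat (D_mat F (d 0)) $ i $ j $ r * e r) *v u) \<le> norm u"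
    (is "norm (?X *v u) \<le> _")
proof (rule norm_le_if_herm_le)
  fix v
  define g where "g t = herm v (F (d t) *v u)" for t
  have ent: "(\<lambda>z. F z $ i $ j) \<in> rat_funs \<Omega>" for i j
    using F by (simp add: rat_matrices_def)
  have d0: "d 0 \<in> \<Omega>" using d(2) by auto
  have g_eq: "g = (\<lambda>t. \<Sum>i\<in>UNIV. cnj (v$i) * (\<Sum>j\<in>UNIV. F (d t) $ i $ j * u$j))"
    by (rule ext) (simp add: g_def herm_def matrix_vector_mult_def)
  have hol: "g holomorphic_on cball 0 1"
    unfolding g_eq
    by (intro holomorphic_intros rat_fun_holomorphic_compose[OF ent] d(2))
       (auto intro: holomorphic_on_subset[OF d(1)])
  have "cmod ((deriv ^^ 1) g 0) \<le> fact 1 * (norm v * norm u) / 1 ^ 1"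
  proof (rule Cauchy_inequality)
    show "g holomorphic_on ball 0 1" by (rule holomorphic_on_subset[OF hol ball_subset_cball])
    show "continuous_on (cball 0 1) g" using hol by (rule holomorphic_on_imp_continuous_on)
    fix t :: complex assume "norm (0 - t) = 1"
    then have "d t \<in> \<Omega>" using d(2) by auto
    then show "cmod (g t) \<le> norm v * norm u"
      unfolding g_def using le by (intro order_trans[OF cmod_herm_le] mult_left_mono) auto
  qed simp
  moreover have der: "((\<lambda>t. F (d t) $ i $ j) has_field_derivative ?X $ i $ j) (at 0)" for i j
    using has_gradientD[OF rat_fun_has_gradient[OF ent d0] refl d(3), of i j]
    by (simp add: tuple_to_mat_def D_mat_def)
  have "(g has_field_derivative
      (\<Sum>i\<in>UNIV. cnj (v$i) * (\<Sum>j\<in>UNIV. ?X $ i $ j * u$j))) (at 0)"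
    unfolding g_eq by (intro DERIV_sum DERIV_cmult DERIV_cmult_right der)
  then have "(g has_field_derivative herm v (?X *v u)) (at 0)"
    by (simp add: herm_def matrix_vector_mult_def)
  then have "deriv g 0 = herm v (?X *v u)" by (rule DERIV_imp_deriv)
  ultimately show "cmod (herm v (?X *v u)) \<le> norm v * norm u" by simp
qed

section \<open>The geometry of the tetrablock\<close>

lemma unimodular_rotation:
  fixes s :: complex
  obtains z where "cmod z = 1" "z * s = of_real (cmod s)"
proof (cases "s = 0")
  case True
  then show ?thesis using that[of 1] by simp
next
  case False
  have "cnj s / of_real (cmod s) * s = of_real (cmod s)"
    using False complex_norm_square[of s] by (simp add: field_simps power2_eq_square)
  then show ?thesis using that[of "cnj s / of_real (cmod s)"] False by (simp add: norm_divide)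
qed

lemma cmod_diff_square: "(cmod (a - b))\<^sup>2 = (cmod a)\<^sup>2 + (cmod b)\<^sup>2 - 2 * Re (cnj a * b)"
  unfolding cmod_power2 by (simp add: algebra_simps power2_eq_square)

text \<open>If \<open>\<bar>1 - b w\<bar> \<le> \<bar>a - c w\<bar>\<close> for some \<open>w\<close>, then \<open>z = (1 - b w) / (a - c w)\<close> is a forbidden zero (\<open>z = 0\<close> if both sides vanish); so the reverse
strict inequality holds on the whole disc. For \<open>\<bar>w\<bar> = 1\<close> the difference of the squares is
\<open>1 - \<bar>a\<bar>\<^sup>2 + \<bar>b\<bar>\<^sup>2 - \<bar>c\<bar>\<^sup>2 - 2 Re (w (b - cnj a c))\<close>, and \<open>w\<close> is chosen to make the last term extremal.\<close>

lemma tetrablock_scalar_bound: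
  fixes a b c :: complex
  assumes nz: "\<And>z w. cmod z \<le> 1 \<Longrightarrow> cmod w \<le> 1 \<Longrightarrow> 1 - a * z - b * w + c * z * w \<noteq> 0"
  shows "2 * cmod (b - cnj a * c) < 1 - (cmod a)\<^sup>2 + (cmod b)\<^sup>2 - (cmod c)\<^sup>2"
proof -
  obtain w where w: "cmod w = 1" "w * (b - cnj a * c) = of_real (cmod (b - cnj a * c))"
    using unimodular_rotation by blast
  have lt: "cmod (a - c * w) < cmod (1 - b * w)"
  proof (rule ccontr)
    assume "\<not> cmod (a - c * w) < cmod (1 - b * w)"
    then have le: "cmod (1 - b * w) \<le> cmod (a - c * w)" by simp
    show False
    proof (cases "a - c * w = 0")
      case True
      then show False using le nz[of 0 w] w(1) by simp
    next
      case False
      define z where "z = (1 - b * w) / (a - c * w)"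
      have "cmod z \<le> 1" using le False by (simp add: z_def norm_divide)
      moreover have "z * (a - c * w) = 1 - b * w" using False by (simp add: z_def)
      then have "1 - a * z - b * w + c * z * w = 0" by (simp add: algebra_simps)
      ultimately show False using nz w(1) by auto
    qed
  qed
  have "(cmod (a - c * w))\<^sup>2 < (cmod (1 - b * w))\<^sup>2" using lt by (simp add: power_strict_mono)
  moreover have "(cmod (1 - b * w))\<^sup>2 = 1 + (cmod b)\<^sup>2 - 2 * Re (b * w)"
    using w(1) by (simp add: cmod_diff_square norm_mult)
  moreover have "(cmod (a - c * w))\<^sup>2 = (cmod a)\<^sup>2 + (cmod c)\<^sup>2 - 2 * Re (cnj a * (c * w))"
    using w(1) unfolding cmod_diff_square by (simp add: norm_mult)
  moreover have "Re (b * w) - Re (cnj a * (c * w)) = cmod (b - cnj a * c)"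
    using arg_cong[OF w(2), of Re] unfolding minus_complex.sel(1)[symmetric] by (simp only: Re_complex_of_real ring_distribs mult_ac)
  ultimately show ?thesis by linarith
qed

lemma zero_in_tetrablock: "0 \<in> tetrablock"
  by (simp add: tetrablock_def)

lemma tetrablock_nonzero:
  assumes "x \<in> tetrablock" "cmod z \<le> 1" "cmod w \<le> 1"
  shows "1 - x$1 * z - x$2 * w + x$3 * z * w \<noteq> 0"
  using assms by (simp add: tetrablock_def)

lemma tetrablock_bound_1:
  assumes "x \<in> tetrablock"
  shows "2 * cmod (x$2 - cnj (x$1) * x$3) < 1 - (cmod (x$1))\<^sup>2 + (cmod (x$2))\<^sup>2 - (cmod (x$3))\<^sup>2"
  by (rule tetrablock_scalar_bound) (rule tetrablock_nonzero[OF assms])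

lemma tetrablock_bound_2:
  assumes "x \<in> tetrablock"
  shows "2 * cmod (x$1 - cnj (x$2) * x$3) < 1 - (cmod (x$2))\<^sup>2 + (cmod (x$1))\<^sup>2 - (cmod (x$3))\<^sup>2"
proof (rule tetrablock_scalar_bound)
  fix z w :: complex assume "cmod z \<le> 1" "cmod w \<le> 1"
  then show "1 - x$2 * z - x$1 * w + x$3 * z * w \<noteq> 0"
    using tetrablock_nonzero[OF assms, of w z] by (simp add: algebra_simps)
qed

lemma tetrablock_coord_less_1:
  assumes "x \<in> tetrablock"
  shows "cmod (x$i) < 1"
proof -
  have *: "cmod a < 1" if "\<And>z. cmod z \<le> 1 \<Longrightarrow> 1 - a * z \<noteq> 0" for a
  proof (rule ccontr)
    assume "\<not> cmod a < 1"
    then have "cmod (1 / a) \<le> 1" "a \<noteq> 0" by (auto simp: norm_divide divide_simps)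
    then show False using that[of "1 / a"] by simp
  qed
  have "cmod (x$1) < 1" using tetrablock_nonzero[OF assms, of _ 0] by (intro *) simp
  moreover have "cmod (x$2) < 1" using tetrablock_nonzero[OF assms, of 0] by (intro *) simp
  moreover have "(cmod (x$3))\<^sup>2 < 1"
    using tetrablock_bound_1[OF assms] tetrablock_bound_2[OF assms]
      norm_ge_zero[of "x$2 - cnj (x$1) * x$3"] norm_ge_zero[of "x$1 - cnj (x$2) * x$3"] by linarith
  then have "cmod (x$3) < 1" by (simp add: power_less_one_iff)
  ultimately show ?thesis using exhaust_3[of i] by auto
qed

lemma closure_tetrablock_coord_le_1:
  assumes "x \<in> closure tetrablock"
  shows "cmod (x$i) \<le> 1"
  by (rule continuous_on_closure_norm_le[OF _ _ assms])
     (auto intro!: continuous_intros less_imp_le[OF tetrablock_coord_less_1])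

lemma compact_closure_tetrablock: "compact (closure tetrablock)"
proof -
  have "norm x \<le> 3" if "x \<in> tetrablock" for x
  proof -
    have "norm x \<le> (\<Sum>i\<in>UNIV. cmod (x$i))"
      unfolding norm_vec_def by (rule L2_set_le_sum) simp
    also have "\<dots> \<le> (\<Sum>i\<in>(UNIV::3 set). 1)"
      by (intro sum_mono less_imp_le tetrablock_coord_less_1 that)
    finally show ?thesis by simp
  qed
  then have "bounded tetrablock" by (auto simp: bounded_iff)
  then show ?thesis by (simp add: compact_closure)
qed

text \<open>Every point of the tetrablock lies on the disc \<open>t \<mapsto> (b1 + cnj b2 t, b2 + cnj b1 t, t)\<close>, at \<open>t = x$3\<close>. The
boundary of this disc consists of points with \<open>x$1 = cnj (x$2) x$3\<close>, \<open>\<bar>x$2\<bar> \<le> 1\<close> and \<open>\<bar>x$3\<bar> = 1\<close>, which form the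
distinguished boundary of the tetrablock. The numbers \<open>b1\<close> and \<open>b2\<close> solve a linear system with
determinant \<open>1 - \<bar>x$3\<bar>\<^sup>2\<close>, and adding the bounds \<open>tetrablock_bound_1\<close> and \<open>tetrablock_bound_2\<close> shows \<open>\<bar>b1\<bar> + \<bar>b2\<bar> \<le> 1\<close>.\<close>

lemma tetrablock_disc:
  assumes "x \<in> tetrablock"
  obtains b1 b2 where "cmod b1 + cmod b2 \<le> 1"
    "x$1 = b1 + cnj b2 * x$3" "x$2 = b2 + cnj b1 * x$3" "cmod (x$3) < 1"
proof
  define t where "t = 1 - (cmod (x$3))\<^sup>2"
  have t: "t > 0" using tetrablock_coord_less_1[OF assms, of 3]
    by (simp add: t_def power_less_one_iff)
  define b1 where "b1 = (x$1 - cnj (x$2) * x$3) / of_real t"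
  define b2 where "b2 = (x$2 - cnj (x$1) * x$3) / of_real t"
  have "cmod (x$1 - cnj (x$2) * x$3) + cmod (x$2 - cnj (x$1) * x$3) \<le> t"
    using tetrablock_bound_1[OF assms] tetrablock_bound_2[OF assms] unfolding t_def by linarith
  then show "cmod b1 + cmod b2 \<le> 1"
    using t by (simp add: b1_def b2_def norm_divide add_divide_distrib[symmetric])
  have tc: "of_real t = 1 - x$3 * cnj (x$3)"
    by (simp add: t_def complex_norm_square del: of_real_power)
  have nz: "1 - x$3 * cnj (x$3) \<noteq> 0" using t tc by (metis less_irrefl of_real_eq_0_iff)
  show "x$1 = b1 + cnj b2 * x$3" "x$2 = b2 + cnj b1 * x$3"
    unfolding b1_def b2_def tc using nz by (simp_all add: divide_simps mult.commute[of "cnj (x$3)"]) (simp_all add: algebra_simps)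
  show "cmod (x$3) < 1" by (rule tetrablock_coord_less_1[OF assms])
qed

lemma continuous_on_vector3:
  fixes f g h :: "'a::topological_space \<Rightarrow> complex"
  assumes "continuous_on S f" "continuous_on S g" "continuous_on S h"
  shows "continuous_on S (\<lambda>t. vector [f t, g t, h t] :: complex^3)"
proof -
  have "vector [f t, g t, h t] = axis 1 (f t) + axis 2 (g t) + (axis 3 (h t) :: complex^3)" for t
    by (simp add: vec_eq_iff forall_3 axis_def)
  moreover have "continuous_on S (\<lambda>t. axis i (k t) :: complex^3)"
    if "continuous_on S k" for k :: "'a \<Rightarrow> complex" and i
  proof -
    have "axis i (k t) = (\<chi> j. if j = i then k t else 0)" for t
      by (simp add: axis_def)
    moreover have "continuous_on S (\<lambda>t. if j = i then k t else 0)" for j :: 3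
      using that by (cases "j = i") auto
    ultimately show ?thesis by (auto intro: continuous_on_vec_lambda)
  qed
  ultimately show ?thesis using assms by (auto intro!: continuous_on_add)
qed

text \<open>Here \<open>1 - x$1 z - x$2 w + x$3 z w\<close> factors as \<open>(1 - a z) (1 - b w)\<close>; shrinking \<open>a\<close> and \<open>b\<close> keeps both factors away
from zero.\<close>

lemma closed_bidisc_in_closure_tetrablock:
  assumes "cmod a \<le> 1" "cmod b \<le> 1"
  shows "vector [a, b, a * b] \<in> closure tetrablock"
proof -
  let ?h = "\<lambda>t. vector [of_real t * a, of_real t * b, (of_real t * a) * (of_real t * b)] :: complex^3"
  have "?h t \<in> tetrablock" if "t \<in> {0<..<1}" for t
    unfolding tetrablock_def
  proof (intro CollectI ballI)
    fix z w :: complex assume zw: "z \<in> cball 0 1" "w \<in> cball 0 1"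
    have "1 - of_real t * c * z \<noteq> 0" if "cmod c \<le> 1" "cmod z \<le> 1" for c z :: complex
    proof -
      have "cmod (of_real t * c * z) \<le> t * 1 * 1"
        unfolding norm_mult using that \<open>t \<in> {0<..<1}\<close> by (intro mult_mono) auto
      then show ?thesis using \<open>t \<in> {0<..<1}\<close> by auto
    qed
    then have "(1 - of_real t * a * z) * (1 - of_real t * b * w) \<noteq> 0" using assms zw by simp
    then show "1 - ?h t $ 1 * z - ?h t $ 2 * w + ?h t $ 3 * z * w \<noteq> 0"
      by (simp add: algebra_simps)
  qed
  then have "?h ` closure {0<..<1} \<subseteq> closure tetrablock"
    by (intro image_closure_subset closed_closure continuous_on_vector3 continuous_intros)
       (use closure_subset in blast)
  moreover have "?h 1 = vector [a, b, a * b]" by simp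
  ultimately show ?thesis by (metis (no_types, lifting) image_subset_iff closure_greaterThanLessThan
      atLeastAtMost_iff zero_le_one order_refl zero_less_one)
qed

lemma third_axis_in_closure_tetrablock:
  assumes "cmod c \<le> 1"
  shows "vector [0, 0, c] \<in> closure tetrablock"
proof -
  let ?h = "\<lambda>t. vector [0, 0, of_real t * c] :: complex^3"
  have "?h t \<in> tetrablock" if "t \<in> {0<..<1}" for t
    unfolding tetrablock_def
  proof (intro CollectI ballI)
    fix z w :: complex assume zw: "z \<in> cball 0 1" "w \<in> cball 0 1"
    have "cmod (of_real t * c * z * w) \<le> t * 1 * 1 * 1"
      unfolding norm_mult using zw assms that by (intro mult_mono) auto
    then have "cmod (of_real t * c * z * w) < 1" using that by auto
    then have "1 + of_real t * c * z * w \<noteq> 0"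
      by (metis add_eq_0_iff norm_minus_cancel norm_one less_irrefl)
    then show "1 - ?h t $ 1 * z - ?h t $ 2 * w + ?h t $ 3 * z * w \<noteq> 0" by simp
  qed
  then have "?h ` closure {0<..<1} \<subseteq> closure tetrablock"
    by (intro image_closure_subset closed_closure continuous_on_vector3 continuous_intros)
       (use closure_subset in blast)
  moreover have "?h 1 = vector [0, 0, c]" by simp
  ultimately show ?thesis by (metis (no_types, lifting) image_subset_iff closure_greaterThanLessThan
      atLeastAtMost_iff zero_le_one order_refl zero_less_one)
qed

section \<open>Contractive functions on the tetrablock with prescribed derivative\<close>

text \<open>Cramer's rule exhibits the entries of an inverse matrix as quotients of polynomials in the entries of
the matrix.\<close>

definition adjugate :: "'a::comm_ring_1^'n^'n \<Rightarrow> 'a^'n^'n" where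
  "adjugate A = (\<chi> k j. det (\<chi> a b. if b = k then (if a = j then 1 else 0) else A$a$b))"

lemma adjugate_mult_vector:
  fixes A :: "'a::field^'n^'n"
  assumes "det A \<noteq> 0"
  shows "A *v (adjugate A *v u) = det A *s u"
proof -
  have col: "A *v (\<chi> k. adjugate A $ k $ j / det A) = axis j 1" for j
    unfolding cramer[OF assms] adjugate_def axis_def by (simp cong: if_cong)
  have "(A ** adjugate A) $ i $ j = (if i = j then det A else 0)" for i j
  proof -
    have "(A ** adjugate A) $ i $ j = det A * (A *v (\<chi> k. adjugate A $ k $ j / det A)) $ i"
      using assms by (simp add: matrix_matrix_mult_def matrix_vector_mult_def sum_distrib_left)
    then show ?thesis by (simp add: col axis_def)
  qed
  then have "A ** adjugate A = mat (det A)" by (simp add: vec_eq_iff mat_def)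
  moreover have "mat (det A) *v u = det A *s u"
  proof -
    have "(\<Sum>j\<in>UNIV. (if i = j then det A else 0) * u$j) = det A * u$i" for i
      by (subst sum.cong[OF refl, of _ _ "\<lambda>j. if j = i then det A * u$i else 0"]) auto
    then show ?thesis by (simp add: vec_eq_iff mat_def matrix_vector_mult_def)
  qed
  ultimately show ?thesis by (simp add: matrix_vector_mul_assoc)
qed

text \<open>A matrix of triples is read as a triple of matrices \<open>(B\<^sub>1, B\<^sub>2, B\<^sub>3)\<close>, of which this is a linear combination.\<close>

definition pencil :: "(complex^3)^'k^'k \<Rightarrow> complex \<Rightarrow> complex \<Rightarrow> complex \<Rightarrow> complex^'k^'k" where
  "pencil B a b c = (\<chi> i j. B$i$j$1 * a + B$i$j$2 * b + B$i$j$3 * c)"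

lemma pencil_scale: "pencil B (s * a) (s * b) (s * c) *v u = s *s (pencil B a b c *v u)"
  by (simp add: vec_eq_iff pencil_def matrix_vector_mult_def sum_distrib_left distrib_left
      distrib_right mult_ac)

lemma pencil_split: "pencil B a b c *v u = pencil B a b 0 *v u + c *s (pencil B 0 0 1 *v u)"
  by (simp add: vec_eq_iff pencil_def matrix_vector_mult_def sum_distrib_left
      distrib_left distrib_right mult_ac sum.distrib)

lemma norm_vec_scale: "norm (c *s (u::complex^'n)) = cmod c * norm u"
  by (simp add: norm_vec_def norm_mult L2_set_right_distrib)

lemma pencil_homogeneous_bound:
  assumes le: "\<And>a b. cmod a \<le> 1 \<Longrightarrow> cmod b \<le> 1 \<Longrightarrow> norm (pencil B a b 0 *v u) \<le> norm u"
    and ab: "cmod a \<le> m" "cmod b \<le> m"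
  shows "norm (pencil B a b 0 *v u) \<le> m * norm u"
proof (cases "m = 0")
  case True
  then have "a = 0" "b = 0" using ab by simp_all
  then show ?thesis using True pencil_scale[of B 0 0 0 0 u] by (simp add: vec_eq_iff)
next
  case False
  then have m: "m > 0" using ab(1) norm_ge_zero[of a] by linarith
  have "norm (pencil B (a / of_real m) (b / of_real m) 0 *v u) \<le> norm u"
    using ab m by (intro le) (auto simp: norm_divide)
  then have "m * norm (pencil B (a / of_real m) (b / of_real m) 0 *v u) \<le> m * norm u"
    using m by simp
  moreover have "pencil B a b 0 *v u = of_real m *s (pencil B (a / of_real m) (b / of_real m) 0 *v u)"
    using m pencil_scale[of B "of_real m" "a / of_real m" "b / of_real m" 0 u] by simp
  ultimately show ?thesis using m by (simp add: norm_vec_scale)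
qed

lemma pencil_scaleR: "pencil (t *\<^sub>R B) a b c = t *\<^sub>R pencil B a b c"
  by (simp add: vec_eq_iff pencil_def scaleR_add_right)

lemma scaleR_eq_vec_scale: "t *\<^sub>R (v::complex^'n) = of_real t *s v"
proof -
  have "t *\<^sub>R v $ i = of_real t * v $ i" for i by (rule scaleR_conv_of_real)
  then show ?thesis by (simp add: vec_eq_iff)
qed

text \<open>The hypothesis on \<open>B = (B\<^sub>1, B\<^sub>2, C)\<close> describes the tuples of minimal norm at most \<open>1\<close>, with the third
matrix a strict contraction. Put \<open>K z = z\<^sub>1 B\<^sub>1 + z\<^sub>2 B\<^sub>2\<close> and \<open>L z = z\<^sub>2 B\<^sub>1\<^sup>* + z\<^sub>1 B\<^sub>2\<^sup>*\<close>. The function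
\<open>z \<mapsto> K z + (z\<^sub>3 - z\<^sub>1 z\<^sub>2) C (1 + L z C)\<^sup>-\<^sup>1\<close> has the derivative \<open>B\<close> at the origin. In the scalar case
\<open>B\<^sub>1 = 1\<close>, \<open>B\<^sub>2 = 0\<close> it is \<open>(z\<^sub>1 + z\<^sub>3 C) / (1 + z\<^sub>2 C)\<close>, one of the fractional linear functions that
define the tetrablock.\<close>

locale contractive_pencil =
  fixes B :: "(complex^3)^'k^'k" and \<rho> :: real
  assumes linear_part: "cmod a \<le> m \<Longrightarrow> cmod b \<le> m \<Longrightarrow> norm (pencil B a b 0 *v u) \<le> m * norm u"
    and third_part: "norm (pencil B 0 0 1 *v u) \<le> \<rho> * norm u"
    and \<rho>: "\<rho> < 1"
begin

abbreviation C :: "complex^'k^'k" where "C \<equiv> pencil B 0 0 1"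

definition K :: "complex^3 \<Rightarrow> complex^'k^'k" where
  "K z = pencil B (z$1) (z$2) 0"

definition L :: "complex^3 \<Rightarrow> complex^'k^'k" where
  "L z = ctrans (pencil B (cnj (z$2)) (cnj (z$1)) 0)"

definition den :: "complex^3 \<Rightarrow> complex^'k^'k" where
  "den z = mat 1 + L z ** C"

definition interpolant :: "complex^3 \<Rightarrow> complex^'k^'k" where
  \<comment> \<open>One fraction per entry, so that the entries are literally quotients of polynomials, also where
      the denominator vanishes.\<close>
  "interpolant z = (\<chi> i j. (K z $ i $ j * det (den z)
     + (z$3 - z$1 * z$2) * (C ** adjugate (den z)) $ i $ j) / det (den z))"

lemma C_le: "norm (C *v u) \<le> norm u"
proof -
  have "\<rho> * norm u \<le> 1 * norm u" using \<rho> by (intro mult_right_mono) auto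
  then show ?thesis using third_part[of u] by simp
qed

text \<open>Here \<open>L z\<close> is the adjoint of a contraction from the pencil and \<open>C\<close> is a strict contraction, so \<open>1 + L z C\<close> is injective.\<close>

lemma det_den_nonzero:
  assumes "cmod (z$1) \<le> 1" "cmod (z$2) \<le> 1"
  shows "det (den z) \<noteq> 0"
proof -
  have L_le: "norm (L z *v w) \<le> 1 * norm w" for w
    unfolding L_def using assms by (intro norm_ctrans_le linear_part) auto
  have "u = 0" if "den z *v u = 0" for u
  proof (rule ccontr)
    assume "u \<noteq> 0"
    have "u + L z *v (C *v u) = 0"
      using that by (simp add: den_def matrix_vector_mult_add_rdistrib matrix_vector_mul_assoc)
    then have "norm u = norm (L z *v (C *v u))"
      by (metis add_eq_0_iff norm_minus_cancel)
    also have "\<dots> \<le> \<rho> * norm u"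
      using L_le[of "C *v u"] third_part[of u] by simp
    also have "\<dots> < norm u" using \<rho> \<open>u \<noteq> 0\<close> by simp
    finally show False by simp
  qed
  then show ?thesis
    unfolding invertible_det_nz[symmetric] invertible_left_inverse matrix_left_invertible_ker by blast
qed

lemma interpolant_mult_vector:
  assumes "det (den z) \<noteq> 0"
  obtains y where "u = y + L z *v (C *v y)"
    "interpolant z *v u = K z *v u + (z$3 - z$1 * z$2) *s (C *v y)"
proof
  define y where "y = (1 / det (den z)) *s (adjugate (den z) *v u)"
  have scale: "A *v (c *s v) = c *s (A *v v)" for A :: "complex^'k^'k" and c v
    by (simp add: vector_scalar_commute)
  have "den z *v y = u"
    unfolding y_def scale adjugate_mult_vector[OF assms] using assms by (simp add: vec_eq_iff)
  then show "u = y + L z *v (C *v y)"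
    by (simp add: den_def matrix_vector_mult_add_rdistrib matrix_vector_mul_assoc)
  have Cy: "C *v y = (1 / det (den z)) *s ((C ** adjugate (den z)) *v u)"
    by (simp add: y_def scale matrix_vector_mul_assoc)
  have "interpolant z $ i $ j = K z $ i $ j
      + (z$3 - z$1 * z$2) * ((1 / det (den z)) * (C ** adjugate (den z)) $ i $ j)" for i j
    unfolding interpolant_def using assms by (simp add: field_simps)
  then show "interpolant z *v u = K z *v u + (z$3 - z$1 * z$2) *s (C *v y)"
    unfolding Cy by (simp add: vec_eq_iff matrix_vector_mult_def distrib_right sum.distrib
        sum_distrib_left mult.assoc)
qed

lemma interpolant_rational:
  assumes "\<And>z. z \<in> \<Omega> \<Longrightarrow> cmod (z$1) \<le> 1 \<and> cmod (z$2) \<le> 1"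
  shows "interpolant \<in> rat_matrices \<Omega>"
proof -
  have K: "is_poly_fun (\<lambda>z. K z $ i $ j)" for i j
    unfolding K_def pencil_def by (simp, intro is_poly_fun_intros)
  have den: "is_poly_fun (\<lambda>z. den z $ i $ j)" for i j
    unfolding den_def L_def ctrans_def pencil_def matrix_matrix_mult_def
    by (simp, intro is_poly_fun_intros)
  have adj: "is_poly_fun (\<lambda>z. adjugate (den z) $ i $ j)" for i j
  proof -
    have "is_poly_fun (\<lambda>z. if b = i then if a = j then 1 else 0 else den z $ a $ b)" for a b
      using den by (cases "b = i"; cases "a = j") (auto intro: is_poly_fun_const)
    then show ?thesis unfolding adjugate_def by (simp add: is_poly_fun_det)
  qed
  define num where "num i j z = K z $ i $ j * det (den z)
     + (z$3 - z$1 * z$2) * (\<Sum>l\<in>UNIV. C $ i $ l * adjugate (den z) $ l $ j)" for i j z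
  have num: "is_poly_fun (num i j)" for i j
    unfolding num_def[abs_def] by (intro is_poly_fun_intros K adj den)
  have interpolant_eq: "interpolant z $ i $ j = num i j z / det (den z)" for z i j
    by (simp add: interpolant_def num_def matrix_matrix_mult_def)
  show ?thesis
    unfolding rat_matrices_def mem_Collect_eq rat_funs_iff
  proof (intro allI)
    fix i j
    show "\<exists>p q. is_poly_fun p \<and> is_poly_fun q \<and> (\<forall>z\<in>\<Omega>. q z \<noteq> 0) \<and> (\<forall>z. interpolant z $ i $ j = p z / q z)"
      using num is_poly_fun_det[OF den] det_den_nonzero assms interpolant_eq
      by (intro exI[of _ "num i j"] exI[of _ "\<lambda>z. det (den z)"]) simp
  qed
qed

text \<open>On the distinguished boundary \<open>L x = x\<^sub>3 K\<^sup>*\<close> and \<open>x\<^sub>3 - x\<^sub>1 x\<^sub>2 = x\<^sub>3 (1 - \<bar>x\<^sub>2\<bar>\<^sup>2)\<close>, with \<open>\<parallel>K\<parallel> \<le> \<bar>x\<^sub>2\<bar>\<close>. So the value of the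
interpolant is an operator Moebius transform of the contraction \<open>x\<^sub>3 C\<close>.\<close>

lemma interpolant_contractive_on_shilov_boundary:
  assumes "cmod (x$2) \<le> 1" "cmod (x$3) = 1" "x$1 = cnj (x$2) * x$3"
  shows "norm (interpolant x *v u) \<le> norm u"
proof -
  have x1: "cmod (x$1) = cmod (x$2)" using assms by (simp add: norm_mult)
  have x3: "x$3 * cnj (x$3) = 1" using assms(2) complex_norm_square[of "x$3"] by simp
  obtain y where y: "u = y + L x *v (C *v y)"
    "interpolant x *v u = K x *v u + (x$3 - x$1 * x$2) *s (C *v y)"
    using interpolant_mult_vector[OF det_den_nonzero] x1 assms(1) by metis
  define c where "c = x$3 *s (C *v y)"
  have "cnj (x$1) * x$3 = x$2"
    using x3 by (simp add: assms(3) mult.assoc mult.commute[of "cnj (x$3)"])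
  then have "L x $ i $ j = x$3 * ctrans (K x) $ i $ j" for i j
    using x3 assms(3) by (simp add: L_def K_def ctrans_def pencil_def algebra_simps)
  then have "L x *v (C *v y) = ctrans (K x) *v c"
    by (simp add: vec_eq_iff c_def matrix_vector_mult_def mult_ac)
  then have u: "u = y + ctrans (K x) *v c" using y(1) by simp
  have "x$3 - x$1 * x$2 = of_real (1 - (cmod (x$2))\<^sup>2) * x$3"
    unfolding assms(3) by (simp add: complex_norm_square algebra_simps del: of_real_power)
  then have "interpolant x *v u = K x *v u + (1 - (cmod (x$2))\<^sup>2) *\<^sub>R c"
    unfolding y(2) c_def scaleR_eq_vec_scale by (simp only: vector_smult_assoc)
  moreover have "norm c \<le> norm y"
    using C_le assms(2) by (simp add: c_def norm_vec_scale)
  moreover have "norm (K x *v v) \<le> cmod (x$2) * norm v" for v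
    unfolding K_def by (intro linear_part) (auto simp: x1)
  ultimately show ?thesis
    using halmos_contraction[of "K x" "cmod (x$2)" c y u] u assms(1) by simp
qed

text \<open>The maximum principle on the disc through \<open>x\<close> reduces the claim to the distinguished boundary. The
function is holomorphic on the disc since \<open>\<bar>b1\<bar> + \<bar>b2\<bar> \<le> 1\<close> bounds the first two coordinates.\<close>

lemma interpolant_contractive_on_tetrablock:
  assumes "x \<in> tetrablock"
  shows "norm (interpolant x *v u) \<le> norm u"
proof -
  obtain b1 b2 where b: "cmod b1 + cmod b2 \<le> 1"
    "x$1 = b1 + cnj b2 * x$3" "x$2 = b2 + cnj b1 * x$3" "cmod (x$3) < 1"
    using tetrablock_disc[OF assms] by metis
  define d :: "complex \<Rightarrow> complex^3" where
    "d t = vector [b1 + cnj b2 * t, b2 + cnj b1 * t, t]" for t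
  have d_x: "d (x$3) = x" using b by (simp add: d_def vec_eq_iff forall_3)
  have d_le: "cmod (d t $ 1) \<le> 1 \<and> cmod (d t $ 2) \<le> 1" if "t \<in> cball 0 1" for t
  proof -
    have le: "cmod (p + cnj q * t) \<le> cmod p + cmod q" for p q
      using that by (intro order_trans[OF norm_triangle_ineq] add_left_mono)
        (simp add: norm_mult mult_left_le)
    show ?thesis using le[of b1 b2] le[of b2 b1] b(1) by (simp add: d_def)
  qed
  define \<Omega> where "\<Omega> = {z::complex^3. cmod (z$1) \<le> 1 \<and> cmod (z$2) \<le> 1}"
  have ent: "(\<lambda>z. interpolant z $ i $ j) \<in> rat_funs \<Omega>" for i j
    using interpolant_rational[of \<Omega>] by (simp add: rat_matrices_def \<Omega>_def)
  have d_hol: "(\<lambda>t. d t $ r) holomorphic_on S" for r S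
    using exhaust_3[of r] by (auto simp: d_def intro!: holomorphic_intros)
  have d_im: "d ` cball 0 1 \<subseteq> \<Omega>" using d_le by (auto simp: \<Omega>_def)
  have hol: "(\<lambda>t. herm v (interpolant (d t) *v u)) holomorphic_on cball 0 1" for v
    unfolding herm_def matrix_vector_mult_def vec_lambda_beta
    by (intro holomorphic_intros rat_fun_holomorphic_compose[OF ent d_hol d_im])
  show ?thesis
  proof (rule norm_le_if_herm_le)
    fix v
    have "cmod (herm v (interpolant (d (x$3)) *v u)) \<le> norm v * norm u"
    proof (rule maximum_modulus_frontier[where S = "cball 0 1" and f = "\<lambda>t. herm v (interpolant (d t) *v u)"])
      show "(\<lambda>t. herm v (interpolant (d t) *v u)) holomorphic_on interior (cball 0 1)"
        by (rule holomorphic_on_subset[OF hol interior_subset])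
      show "continuous_on (closure (cball 0 1)) (\<lambda>t. herm v (interpolant (d t) *v u))"
        using holomorphic_on_imp_continuous_on[OF hol] by simp
      fix t :: complex assume "t \<in> frontier (cball 0 1)"
      then have t: "cmod t = 1" by simp
      then have "cnj t * t = 1" by (metis complex_norm_square mult.commute of_real_1 power_one)
      then have "d t $ 1 = cnj (d t $ 2) * d t $ 3"
        by (simp add: d_def algebra_simps)
      then have "norm (interpolant (d t) *v u) \<le> norm u"
        using d_le[of t] t by (intro interpolant_contractive_on_shilov_boundary) (auto simp: d_def)
      then show "cmod (herm v (interpolant (d t) *v u)) \<le> norm v * norm u"
        by (intro order_trans[OF cmod_herm_le] mult_left_mono) auto
    qed (use b(4) in auto)
    then show "cmod (herm v (interpolant x *v u)) \<le> norm v * norm u" by (simp add: d_x)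
  qed
qed

lemma interpolant_rational_closure_tetrablock: "interpolant \<in> rat_matrices (closure tetrablock)"
  by (rule interpolant_rational) (simp add: closure_tetrablock_coord_le_1)

lemma interpolant_contractive_on_closure_tetrablock:
  assumes "x \<in> closure tetrablock"
  shows "norm (interpolant x *v u) \<le> norm u"
proof (rule continuous_on_closure_norm_le[OF _ _ assms])
  have "(\<lambda>z. interpolant z $ i $ j) \<in> rat_funs (closure tetrablock)" for i j
    using interpolant_rational_closure_tetrablock by (simp add: rat_matrices_def)
  then show "continuous_on (closure tetrablock) (\<lambda>z. interpolant z *v u)"
    unfolding matrix_vector_mult_def
    by (intro continuous_on_vec_lambda continuous_intros rat_fun_continuous_on)
qed (simp add: interpolant_contractive_on_tetrablock)

text \<open>On the first two axes the factor \<open>z\<^sub>3 - z\<^sub>1 z\<^sub>2\<close> vanishes, on the third one \<open>L\<close> does. Hence the interpolant is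
linear on each axis, and its partial derivatives need no computation.\<close>

lemma interpolant_on_axis:
  assumes "cmod t < 1"
  shows "interpolant (axis r t) $ i $ j = B$i$j$r * t"
proof -
  let ?z = "axis r t :: complex^3"
  have "norm (?z $ s) \<le> 1" for s using assms by (simp add: axis_def)
  then have nz: "det (den ?z) \<noteq> 0" by (intro det_den_nonzero) auto
  show ?thesis
  proof (cases "r = 3")
    case True
    have "L ?z = 0" using True by (simp add: L_def vec_eq_iff ctrans_def pencil_def axis_def)
    then have den: "den ?z = mat 1" by (simp add: den_def vec_eq_iff matrix_matrix_mult_def)
    have "adjugate (mat 1 :: complex^'k^'k) *v w = w" for w
      using adjugate_mult_vector[of "mat 1 :: complex^'k^'k" w] by simp
    then have "adjugate (mat 1 :: complex^'k^'k) = mat 1" by (simp add: matrix_eq)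
    moreover have "?z$1 = 0" "?z$2 = 0" "?z$3 = t" using True by (simp_all add: axis_def)
    ultimately show ?thesis unfolding interpolant_def den K_def vec_lambda_beta by (simp add: pencil_def True)
  next
    case False
    then consider "r = 1" | "r = 2" using exhaust_3[of r] by blast
    then show ?thesis
      by cases (use nz in \<open>simp_all add: interpolant_def K_def pencil_def axis_def\<close>)
  qed
qed

lemma interpolant_zero: "interpolant 0 = 0"
proof -
  have axis: "axis 1 0 = (0::complex^3)" by (simp add: axis_def vec_eq_iff)
  have "interpolant (axis 1 0) $ i $ j = 0" for i j by (simp add: interpolant_on_axis)
  then show ?thesis unfolding axis by (simp add: vec_eq_iff)
qed

lemma tuple_to_mat_D_mat_ext: "tuple_to_mat (D_mat interpolant 0) = B"
proof -
  have "partial_deriv r (\<lambda>z. interpolant z $ i $ j) 0 = B$i$j$r" for i j r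
    unfolding partial_deriv_def
  proof (rule DERIV_imp_deriv)
    have "((\<lambda>t. B$i$j$r * t) has_field_derivative B$i$j$r) (at 0)"
      by (auto intro!: derivative_eq_intros)
    then show "((\<lambda>t. interpolant (0 + axis r t) $ i $ j) has_field_derivative B$i$j$r) (at 0)"
      by (rule has_field_derivative_transform_within_open[where S = "ball 0 1"])
         (simp_all add: interpolant_on_axis)
  qed
  then show ?thesis by (simp add: vec_eq_iff tuple_to_mat_def D_mat_def)
qed

lemma in_cot_ball: "B \<in> cot_ball (closure tetrablock) 0"
proof -
  have "rat_norm (closure tetrablock) interpolant \<le> 1"
    unfolding rat_norm_def
  proof (rule cSUP_least)
    show "closure tetrablock \<noteq> {}" using zero_in_tetrablock closure_subset by blast
    show "op_norm (interpolant z) \<le> 1" if "z \<in> closure tetrablock" for z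
      using interpolant_contractive_on_closure_tetrablock[OF that] by (simp add: op_norm_le_1_iff)
  qed
  then have "D_mat interpolant 0 \<in> {D_mat F 0 | F. F \<in> rat_matrices (closure tetrablock)
      \<and> rat_norm (closure tetrablock) F \<le> 1 \<and> F 0 = 0}"
    using interpolant_rational_closure_tetrablock interpolant_zero by auto
  then have "tuple_to_mat (D_mat interpolant 0) \<in> cot_ball (closure tetrablock) 0"
    unfolding cot_ball_def by (intro subsetD[OF closure_subset] imageI)
  then show ?thesis by (simp add: tuple_to_mat_D_mat_ext)
qed

end

section \<open>Derivatives of contractive functions\<close>

text \<open>Compactness makes the supremum in the definition of the norm an upper bound.\<close>

lemma op_norm_le_rat_norm:
  assumes "compact \<Omega>" "F \<in> rat_matrices \<Omega>" "z \<in> \<Omega>"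
  shows "op_norm (F z) \<le> rat_norm \<Omega> F"
proof -
  let ?g = "\<lambda>z. \<Sum>i\<in>UNIV. \<Sum>j\<in>UNIV. cmod (F z $ i $ j)"
  have "(\<lambda>z. F z $ i $ j) \<in> rat_funs \<Omega>" for i j
    using assms(2) by (simp add: rat_matrices_def)
  then have "continuous_on \<Omega> ?g"
    by (intro continuous_intros rat_fun_continuous_on)
  then have "bdd_above (?g ` \<Omega>)"
    using assms(1) by (intro bounded_imp_bdd_above compact_imp_bounded compact_continuous_image)
  then obtain M where M: "?g z \<le> M" if "z \<in> \<Omega>" for z
    by (auto simp: bdd_above_def)
  have "bdd_above ((\<lambda>z. op_norm (F z)) ` \<Omega>)"
    by (rule bdd_aboveI2[of _ _ M]) (rule order_trans[OF op_norm_le_sum_entries M])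
  then show ?thesis unfolding rat_norm_def using assms(3) by (intro cSUP_upper)
qed

text \<open>The discs \<open>t \<mapsto> (a t, b t, a b t\<^sup>2)\<close> and \<open>t \<mapsto> (0, 0, t)\<close> lie in the closed tetrablock and have the
derivatives \<open>(a, b, 0)\<close> and \<open>(0, 0, 1)\<close>.\<close>

lemma unit_ball_derivative_pencil:
  fixes F :: "complex^3 \<Rightarrow> complex^'k^'k"
  assumes F: "F \<in> rat_matrices (closure tetrablock)" "rat_norm (closure tetrablock) F \<le> 1"
  defines "X \<equiv> tuple_to_mat (D_mat F 0)"
  shows "cmod a \<le> 1 \<Longrightarrow> cmod b \<le> 1 \<Longrightarrow> norm (pencil X a b 0 *v u) \<le> norm u"
    and "norm (pencil X 0 0 1 *v u) \<le> norm u"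
proof -
  have le: "norm (F z *v u) \<le> norm u" if "z \<in> closure tetrablock" for z u
    using op_norm_le_rat_norm[OF compact_closure_tetrablock F(1) that] F(2)
      op_norm_le_1_iff[of "F z"] by simp
  have disc: "norm (pencil X a b c *v u) \<le> norm u"
    if d: "\<And>t. cmod t \<le> 1 \<Longrightarrow> vector [a * t, b * t, s * t^2 + c * t] \<in> closure tetrablock" for a b c s
  proof -
    let ?d = "\<lambda>t. vector [a * t, b * t, s * t^2 + c * t] :: complex^3"
    have d0: "?d 0 = 0" by (simp add: vec_eq_iff forall_3)
    have "norm ((\<chi> i j. \<Sum>r\<in>UNIV. tuple_to_mat (D_mat F (?d 0)) $ i $ j $ r * vector [a, b, c] $ r) *v u) \<le> norm u"
    proof (rule matrix_schwarz[OF F(1) le])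
      show "(\<lambda>t. ?d t $ r) holomorphic_on UNIV" for r
        using exhaust_3[of r] by (auto intro!: holomorphic_intros)
      show "?d ` cball 0 1 \<subseteq> closure tetrablock" using d by auto
      show "((\<lambda>t. ?d t $ r) has_field_derivative vector [a, b, c] $ r) (at 0)" for r
        using exhaust_3[of r] by (auto intro!: derivative_eq_intros)
    qed
    then show ?thesis unfolding d0 X_def by (simp add: pencil_def sum_3)
  qed
  show "norm (pencil X a b 0 *v u) \<le> norm u" if "cmod a \<le> 1" "cmod b \<le> 1"
  proof (rule disc[of _ _ "a * b"])
    fix t :: complex assume t: "cmod t \<le> 1"
    have "cmod (a * t) \<le> 1" "cmod (b * t) \<le> 1"
      using that t by (auto simp: norm_mult intro: mult_le_one)
    from closed_bidisc_in_closure_tetrablock[OF this]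
    show "vector [a * t, b * t, a * b * t^2 + 0 * t] \<in> closure tetrablock"
      by (simp add: power2_eq_square mult_ac)
  qed
  show "norm (pencil X 0 0 1 *v u) \<le> norm u"
    by (rule disc[of _ _ 0]) (simp add: third_axis_in_closure_tetrablock)
qed

section \<open>The dual ball and the minimal norm\<close>

interpretation l1_sum: vector_space_prod "(*s) :: complex \<Rightarrow> complex^2 \<Rightarrow> complex^2" "(*) :: complex \<Rightarrow> complex \<Rightarrow> complex"
  by unfold_locales

lemma l1_sum_scale_simps [simp]: "fst (l1_sum_scale c p) = c *s fst p" "snd (l1_sum_scale c p) = c * snd p"
  by (simp_all add: l1_sum_scale_def l1_sum.scale_def)

lemma vector_space_l1_sum_scale: "vector_space l1_sum_scale"
  unfolding l1_sum_scale_def by (rule l1_sum.p.vector_space_axioms)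

lemma linear_l1_sum_iff:
  "Vector_Spaces.linear l1_sum_scale (*) f \<longleftrightarrow>
    (\<forall>p q. f (p + q) = f p + f q) \<and> (\<forall>c p. f (l1_sum_scale c p) = c * (f p :: complex))"
  by (simp add: Vector_Spaces.linear_iff vector_space_l1_sum_scale
      vector_space_over_itself.vector_space_axioms)

lemma l1_sum_norm_eq: "l1_sum_norm p = max (cmod (fst p $ 1) + cmod (fst p $ 2)) (cmod (snd p))"
  by (simp add: l1_sum_norm_def dsum_inf_norm_def l1_norm_def sum_2)

definition functional :: "complex \<Rightarrow> complex \<Rightarrow> complex \<Rightarrow> (complex^2) \<times> complex \<Rightarrow> complex" where
  "functional a b c p = fst p $ 1 * a + fst p $ 2 * b + snd p * c"

text \<open>The dual of \<open>\<ell>\<^sub>1\<^sup>2 \<oplus>\<^sub>\<infinity> \<complex>\<close> is \<open>\<ell>\<^sub>\<infinity>\<^sup>2 \<oplus>\<^sub>1 \<complex>\<close>. The bounds on the coefficients come from testing on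
vectors with one coordinate in each summand, rotated so that the two terms add up.\<close>

lemma dual_ball_eq:
  "dual_ball l1_sum_scale l1_sum_norm
    = {functional a b c | a b c. cmod a + cmod c \<le> 1 \<and> cmod b + cmod c \<le> 1}"
proof (intro subset_antisym subsetI)
  fix f assume "f \<in> dual_ball l1_sum_scale l1_sum_norm"
  then have lin: "\<And>p q. f (p + q) = f p + f q" "\<And>c p. f (l1_sum_scale c p) = c * f p"
    and le: "\<And>p. l1_sum_norm p \<le> 1 \<Longrightarrow> cmod (f p) \<le> 1"
    by (auto simp: dual_ball_def linear_l1_sum_iff)
  define a b c where "a = f (axis 1 1, 0)" and "b = f (axis 2 1, 0)" and "c = f (0, 1)"
  have f: "f = functional a b c"
  proof
    fix p
    have "p = l1_sum_scale (fst p $ 1) (axis 1 1, 0) + l1_sum_scale (fst p $ 2) (axis 2 1, 0)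
        + l1_sum_scale (snd p) (0, 1)"
      by (simp add: prod_eq_iff vec_eq_iff forall_2 axis_def)
    then have "f p = f (l1_sum_scale (fst p $ 1) (axis 1 1, 0) + l1_sum_scale (fst p $ 2) (axis 2 1, 0)
        + l1_sum_scale (snd p) (0, 1))" by simp
    also have "\<dots> = functional a b c p"
      unfolding lin by (simp add: functional_def a_def b_def c_def)
    finally show "f p = functional a b c p" .
  qed
  obtain za where za: "cmod za = 1" "za * a = of_real (cmod a)" using unimodular_rotation by blast
  obtain zb where zb: "cmod zb = 1" "zb * b = of_real (cmod b)" using unimodular_rotation by blast
  obtain zc where zc: "cmod zc = 1" "zc * c = of_real (cmod c)" using unimodular_rotation by blast
  have "cmod (f (axis 1 za, zc)) \<le> 1" "cmod (f (axis 2 zb, zc)) \<le> 1"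
    using za(1) zb(1) zc(1) by (intro le; simp add: l1_sum_norm_eq axis_def)+
  moreover have "f (axis 1 za, zc) = of_real (cmod a + cmod c)"
    "f (axis 2 zb, zc) = of_real (cmod b + cmod c)"
    by (simp_all add: f functional_def axis_def za zb zc)
  ultimately have "cmod a + cmod c \<le> 1" "cmod b + cmod c \<le> 1"
    by (simp_all del: of_real_add)
  then show "f \<in> {functional a b c | a b c. cmod a + cmod c \<le> 1 \<and> cmod b + cmod c \<le> 1}"
    using f by blast
next
  fix f assume "f \<in> {functional a b c | a b c. cmod a + cmod c \<le> 1 \<and> cmod b + cmod c \<le> 1}"
  then obtain a b c where f: "f = functional a b c" and abc: "cmod a + cmod c \<le> 1" "cmod b + cmod c \<le> 1"
    by blast
  have "cmod (f p) \<le> 1" if "l1_sum_norm p \<le> 1" for p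
  proof -
    have p: "cmod (fst p $ 1) + cmod (fst p $ 2) \<le> 1" "cmod (snd p) \<le> 1"
      using that by (auto simp: l1_sum_norm_eq)
    have "cmod (f p) \<le> cmod (fst p $ 1) * cmod a + cmod (fst p $ 2) * cmod b + cmod (snd p) * cmod c"
      unfolding f functional_def norm_mult[symmetric]
      by (intro order_trans[OF norm_triangle_ineq] add_right_mono norm_triangle_ineq)
    also have "\<dots> \<le> cmod (fst p $ 1) * (1 - cmod c) + cmod (fst p $ 2) * (1 - cmod c) + 1 * cmod c"
      using abc p by (intro add_mono mult_left_mono mult_right_mono) auto
    also have "\<dots> = (cmod (fst p $ 1) + cmod (fst p $ 2)) * (1 - cmod c) + cmod c"
      by (simp add: algebra_simps)
    also have "\<dots> \<le> 1 * (1 - cmod c) + cmod c"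
      using abc p norm_ge_zero[of a] by (intro add_right_mono mult_right_mono) linarith+
    finally show ?thesis by simp
  qed
  moreover have "Vector_Spaces.linear l1_sum_scale (*) f"
    unfolding linear_l1_sum_iff f functional_def by (simp add: algebra_simps)
  ultimately show "f \<in> dual_ball l1_sum_scale l1_sum_norm" by (simp add: dual_ball_def)
qed

lemma map_matrix_functional_ident:
  "map_matrix (functional a b c) (map_matrix ident B) = pencil B a b c"
  by (simp add: vec_eq_iff map_matrix_def pencil_def functional_def ident_def)

lemma min_norm_le_iff:
  "min_norm l1_sum_scale l1_sum_norm (map_matrix ident B) \<le> s \<longleftrightarrow>
    (\<forall>a b c. cmod a + cmod c \<le> 1 \<longrightarrow> cmod b + cmod c \<le> 1 \<longrightarrow> op_norm (pencil B a b c) \<le> s)"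
proof -
  let ?D = "dual_ball l1_sum_scale l1_sum_norm"
  have ne: "?D \<noteq> {}"
    unfolding dual_ball_eq by (auto intro!: exI[of _ 0])
  let ?M = "\<Sum>i\<in>UNIV. \<Sum>j\<in>UNIV. cmod (B$i$j$1) + cmod (B$i$j$2) + cmod (B$i$j$3)"
  have "op_norm (pencil B a b c) \<le> ?M" if "cmod a + cmod c \<le> 1" "cmod b + cmod c \<le> 1" for a b c
  proof -
    have abc: "cmod a \<le> 1" "cmod b \<le> 1" "cmod c \<le> 1"
      using that norm_ge_zero[of a] norm_ge_zero[of b] norm_ge_zero[of c] by linarith+
    have "cmod (x * a + y * b + z * c) \<le> cmod x + cmod y + cmod z" for x y z
      using abc by (intro norm_triangle_le add_mono) (simp_all add: norm_mult mult_left_le)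
    then have "(\<Sum>i\<in>UNIV. \<Sum>j\<in>UNIV. cmod (pencil B a b c $ i $ j)) \<le> ?M"
      by (intro sum_mono) (simp add: pencil_def)
    then show ?thesis using op_norm_le_sum_entries order_trans by blast
  qed
  then have "bdd_above ((\<lambda>f. op_norm (map_matrix f (map_matrix ident B))) ` ?D)"
    by (intro bdd_aboveI2[of _ _ ?M]) (auto simp: dual_ball_eq map_matrix_functional_ident)
  then have "min_norm l1_sum_scale l1_sum_norm (map_matrix ident B) \<le> s
      \<longleftrightarrow> (\<forall>f\<in>?D. op_norm (map_matrix f (map_matrix ident B)) \<le> s)"
    unfolding min_norm_def by (rule cSUP_le_iff[OF ne])
  also have "\<dots> \<longleftrightarrow> (\<forall>a b c. cmod a + cmod c \<le> 1 \<longrightarrow> cmod b + cmod c \<le> 1 \<longrightarrow>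
      op_norm (pencil B a b c) \<le> s)"
    unfolding dual_ball_eq map_matrix_functional_ident[symmetric] by blast
  finally show ?thesis .
qed

lemma min_norm_scaleR:
  fixes B :: "(complex^3)^'k^'k"
  shows "min_norm l1_sum_scale l1_sum_norm (map_matrix ident (t *\<^sub>R B))
    = \<bar>t\<bar> * min_norm l1_sum_scale l1_sum_norm (map_matrix ident B)"
    (is "?N (t *\<^sub>R B) = _ * ?N B")
proof (cases "t = 0")
  case True
  have "op_norm (0 :: complex^'k^'k) = 0"
    using op_norm_scaleR[of 0 "0 :: complex^'k^'k"] by simp
  moreover have "pencil (0 :: (complex^3)^'k^'k) a b c = 0" for a b c
    using pencil_scaleR[of 0 "0 :: (complex^3)^'k^'k"] by simp
  ultimately have "?N 0 \<le> s \<longleftrightarrow> 0 \<le> s" for s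
    unfolding min_norm_le_iff by (simp, metis add.right_neutral norm_zero zero_le_one)
  then have "?N 0 = 0" by (meson order_antisym order_refl)
  then show ?thesis using True by simp
next
  case False
  have "?N (t *\<^sub>R B) \<le> s \<longleftrightarrow> \<bar>t\<bar> * ?N B \<le> s" for s
  proof -
    have "?N (t *\<^sub>R B) \<le> s \<longleftrightarrow> ?N B \<le> s / \<bar>t\<bar>"
      unfolding min_norm_le_iff pencil_scaleR op_norm_scaleR
      using False by (simp add: pos_le_divide_eq mult.commute)
    then show ?thesis using False by (simp add: pos_le_divide_eq mult.commute)
  qed
  then show ?thesis by (meson order_antisym order_refl)
qed

lemma min_norm_nonneg: "0 \<le> min_norm l1_sum_scale l1_sum_norm (map_matrix ident B)"
proof -
  have "op_norm (pencil B 0 0 0) \<le> min_norm l1_sum_scale l1_sum_norm (map_matrix ident B)"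
    using min_norm_le_iff[of B "min_norm l1_sum_scale l1_sum_norm (map_matrix ident B)"] by simp
  then show ?thesis using op_norm_nonneg order_trans by blast
qed

text \<open>By convexity it suffices to test on the functionals that live on one of the two summands: a functional
with \<open>\<bar>a\<bar>, \<bar>b\<bar> \<le> 1 - \<bar>c\<bar>\<close> splits into a part of norm at most \<open>1 - \<bar>c\<bar>\<close> on the first summand and a part of norm \<open>\<bar>c\<bar>\<close>
on the second.\<close>

lemma min_norm_le_1_iff:
  "min_norm l1_sum_scale l1_sum_norm (map_matrix ident B) \<le> 1 \<longleftrightarrow>
    (\<forall>a b u. cmod a \<le> 1 \<longrightarrow> cmod b \<le> 1 \<longrightarrow> norm (pencil B a b 0 *v u) \<le> norm u)
    \<and> (\<forall>u. norm (pencil B 0 0 1 *v u) \<le> norm u)"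
  (is "_ \<longleftrightarrow> ?A \<and> ?C")
proof
  assume "min_norm l1_sum_scale l1_sum_norm (map_matrix ident B) \<le> 1"
  then have *: "norm (pencil B a b c *v u) \<le> norm u"
    if "cmod a + cmod c \<le> 1" "cmod b + cmod c \<le> 1" for a b c u
    using that unfolding min_norm_le_iff op_norm_le_1_iff by blast
  show "?A \<and> ?C" by (auto intro!: *)
next
  assume AC: "?A \<and> ?C"
  have "norm (pencil B a b c *v u) \<le> norm u" if abc: "cmod a + cmod c \<le> 1" "cmod b + cmod c \<le> 1" for a b c u
  proof -
    have "norm (pencil B a b 0 *v u) \<le> (1 - cmod c) * norm u"
      using AC abc by (intro pencil_homogeneous_bound) auto
    moreover have "norm (c *s (pencil B 0 0 1 *v u)) \<le> cmod c * norm u"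
      using AC by (simp add: norm_vec_scale mult_left_mono)
    ultimately have "norm (pencil B a b c *v u) \<le> (1 - cmod c) * norm u + cmod c * norm u"
      unfolding pencil_split[of B a b c] by (intro norm_triangle_le add_mono)
    then show ?thesis by (simp add: algebra_simps)
  qed
  then show "min_norm l1_sum_scale l1_sum_norm (map_matrix ident B) \<le> 1"
    unfolding min_norm_le_iff op_norm_le_1_iff by blast
qed

text \<open>Discs give one inclusion. For the other one, \<open>t B\<close> with \<open>t < 1\<close> is the derivative of an interpolant, and
the closure in the definition of the cotangent ball takes care of \<open>t \<rightarrow> 1\<close>.\<close>

lemma cot_ball_tetrablock:
  "cot_ball (closure tetrablock) 0
    = {B :: (complex^3)^'k^'k. min_norm l1_sum_scale l1_sum_norm (map_matrix ident B) \<le> 1}"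
proof (intro subset_antisym)
  have cont: "continuous_on UNIV (\<lambda>B :: (complex^3)^'k^'k. pencil B a b c *v u)" for a b c u
    unfolding pencil_def matrix_vector_mult_def vec_lambda_beta
    by (intro continuous_on_vec_lambda continuous_intros)
  have "closed {B :: (complex^3)^'k^'k. min_norm l1_sum_scale l1_sum_norm (map_matrix ident B) \<le> 1}"
    unfolding min_norm_le_1_iff
    by (intro closed_Collect_conj closed_Collect_all closed_Collect_imp open_Collect_const
        closed_Collect_le continuous_intros cont)
  then show "cot_ball (closure tetrablock) 0
      \<subseteq> {B :: (complex^3)^'k^'k. min_norm l1_sum_scale l1_sum_norm (map_matrix ident B) \<le> 1}"
    unfolding cot_ball_def
    by (rule closure_minimal[rotated]) (auto simp: min_norm_le_1_iff unit_ball_derivative_pencil)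
next
  show "{B :: (complex^3)^'k^'k. min_norm l1_sum_scale l1_sum_norm (map_matrix ident B) \<le> 1}
      \<subseteq> cot_ball (closure tetrablock) 0"
  proof
    fix B :: "(complex^3)^'k^'k"
    assume "B \<in> {B. min_norm l1_sum_scale l1_sum_norm (map_matrix ident B) \<le> 1}"
    then have B: "\<And>a b u. cmod a \<le> 1 \<Longrightarrow> cmod b \<le> 1 \<Longrightarrow> norm (pencil B a b 0 *v u) \<le> norm u"
      "\<And>u. norm (pencil B 0 0 1 *v u) \<le> norm u"
      by (auto simp: min_norm_le_1_iff)
    \<comment> \<open>Scaling turns the third matrix into a strict contraction, which keeps the denominator of the
      interpolant invertible.\<close>
    have "t *\<^sub>R B \<in> cot_ball (closure tetrablock) 0" if t: "t \<in> {0<..<1}" for t :: real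
    proof -
      have scale: "norm (pencil (t *\<^sub>R B) a b c *v u) = t * norm (pencil B a b c *v u)" for a b c u
      proof -
        have "pencil (t *\<^sub>R B) a b c *v u = t *\<^sub>R (pencil B a b c *v u)"
          unfolding pencil_scaleR by (rule scaleR_matrix_vector_mult)
        then show ?thesis using t by simp
      qed
      interpret contractive_pencil "t *\<^sub>R B" t
      proof
        fix a b m u assume ab: "cmod a \<le> m" "cmod b \<le> m"
        have "norm (pencil B a b 0 *v u) \<le> m * norm u"
          using B(1) ab by (rule pencil_homogeneous_bound)
        moreover have "t * norm (pencil B a b 0 *v u) \<le> 1 * norm (pencil B a b 0 *v u)"
          using t by (intro mult_right_mono) auto
        ultimately show "norm (pencil (t *\<^sub>R B) a b 0 *v u) \<le> m * norm u"
          unfolding scale by linarith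
      next
        show "norm (pencil (t *\<^sub>R B) 0 0 1 *v u) \<le> t * norm u" for u
          unfolding scale using t B(2) by (intro mult_left_mono) auto
        show "t < 1" using t by simp
      qed
      show ?thesis by (rule in_cot_ball)
    qed
    then have "(\<lambda>t. t *\<^sub>R B) ` closure {0<..<1::real} \<subseteq> cot_ball (closure tetrablock) 0"
      by (intro image_closure_subset continuous_intros) (auto simp: cot_ball_def)
    moreover have "(1::real) \<in> closure {0<..<1}" by simp
    ultimately show "B \<in> cot_ball (closure tetrablock) 0"
      by (metis image_subset_iff scaleR_one)
  qed
qed

lemma ident_linear: "Vector_Spaces.linear (*s) l1_sum_scale ident"
  unfolding Vector_Spaces.linear_iff
  by (simp add: vector_space_l1_sum_scale vec.vector_space_axioms ident_def prod_eq_iff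
      vec_eq_iff forall_2)

lemma bij_ident: "bij ident"
  by (rule bij_betw_byWitness[where f' = "\<lambda>p. vector [fst p $ 1, fst p $ 2, snd p]"])
     (auto simp: ident_def prod_eq_iff vec_eq_iff forall_2 forall_3)

lemma bij_map_matrix:
  assumes "bij f"
  shows "bij (map_matrix f)"
  by (rule bij_betw_byWitness[where f' = "map_matrix (inv f)"])
     (use assms in \<open>auto simp: map_matrix_def vec_eq_iff bij_is_inj bij_is_surj surj_f_inv_f\<close>)

theorem theorem2p8:
  shows "Vector_Spaces.linear (*s) l1_sum_scale ident
    \<and> bij (map_matrix ident :: (complex^3)^'k^'k \<Rightarrow> ((complex^2) \<times> complex)^'k^'k)
    \<and> (\<forall>B :: (complex^3)^'k^'k.
          min_norm l1_sum_scale l1_sum_norm (map_matrix ident B)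
            = cot_norm (closure tetrablock) 0 B)"
proof (intro conjI allI)
  show "Vector_Spaces.linear (*s) l1_sum_scale ident" by (rule ident_linear)
  show "bij (map_matrix ident :: (complex^3)^'k^'k \<Rightarrow> ((complex^2) \<times> complex)^'k^'k)"
    by (intro bij_map_matrix bij_ident)
  show "min_norm l1_sum_scale l1_sum_norm (map_matrix ident B) = cot_norm (closure tetrablock) 0 B"
    for B :: "(complex^3)^'k^'k"
    by (rule cot_norm_unique[symmetric])
       (simp_all add: min_norm_nonneg min_norm_scaleR cot_ball_tetrablock)
qed

end
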